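(* Let $V$ be a real vector space of finite dimension $n\ge2$, let $\Gamma$ be a finitely generated group, let $\Lambda=(A,B)$ be a finite directed graph, let $R:A\to\Gamma$ be an injective map, and let $o$ be a point of the $\mathrm{PGL}(V)$-Riemannian symmetric space $X$, with associated Cartan projection $\mu$. Let $\rho:\Gamma\to\mathrm{PGL}(V)$ be a representation with the following two properties. (1) There is some $C>0$ such that for every $(R,\Lambda)$-directed sequence $(\eta_i)_{i=0}^\infty$ in $\Gamma$ there is a maximal flat $\mathbf F\subset X$ with $d_X(\rho(\eta_i)\cdot o,\mathbf F)\le C$ for all $i\ge0$. (2) If $(\gamma_i)_i$ is a sequence in $\Gamma$ such that for each $i$ there are a positive integer $l_i$ and an $(R,\Lambda)$-directed sequence $(\eta_{i,l})_{l=0}^\infty$ with $\gamma_i=\eta_{i,l_i}$, and $\lim_{i\to\infty}l_i=\infty$, then $\lim_{i\to\infty}\alpha(\mu(\rho(\gamma_i)))=\infty$ for every $\alpha\in\Delta$. Then $\rho$ is $(R,\Lambda)$-directed Anosov.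
   Context: Directed graphs. A finite directed graph $\Lambda=(A,B)$ consists of a finite set $A$ of vertices and a set $B\subset A\times A$ of directed edges. A directed ray in $\Lambda$ is a sequence $(p_i)_{i=1}^\infty$ in $A$ with $(p_i,p_{i+1})\in B$ for all $i>0$. A sequence $(\eta_i)_{i=0}^\infty$ in $\Gamma$ is $(R,\Lambda)$-directed if $\eta_0=\mathrm{id}$ and there is a directed ray $(p_i)_{i=1}^\infty$ with $\eta_i=R(p_1)R(p_2)\cdots R(p_i)$ for all $i>0$. Symmetric space and Cartan projection. $X$ is the set of inner products on $V$ up to positive scaling, with its natural transitive $\mathrm{PGL}(V)$-action. The point $o\in X$ is a scalar class of inner products. For $g\in\mathrm{PGL}(V)$ let $\bar g\in\mathrm{GL}(V)$ be a representative with $|\det\bar g|=1$ and singular values $\mu_1(\bar g)\ge\dots\ge\mu_n(\bar g)$ with respect to $o$; put $\mu(g)=(\log\mu_1(\bar g),\dots,\log\mu_n(\bar g))$. $d_X$ is the $\mathrm{PGL}(V)$-invariant Riemannian distance on $X$, normalized so that $d_X(o,g\cdot o)=\|\mu(g)\|$ (Euclidean norm). A flat is a totally geodesic subspace of $X$ all of whose sectional curvatures vanish; maximal flats have dimension $n-1$ (each is the set of classes of inner products for which some fixed decomposition of $V$ into $n$ lines is orthogonal). Let $\Delta=\{\alpha_1,\dots,\alpha_{n-1}\}$ with $\alpha_k(x_1,\dots,x_n)=x_k-x_{k+1}$. Directed Anosov. Equip $\Gamma$ with the word metric $d_S$ of a finite generating set $S$. A sequence is a $(k,k')$-quasi-geodesic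 if $\frac1k|i-j|-k'\le d_S(\eta_i,\eta_j)\le k|i-j|+k'$ for all $i,j$. $\rho$ is $(R,\Lambda)$-directed Anosov if for all $k,k'>0$ there exist $\kappa,\kappa'>0$ such that for all $(R,\Lambda)$-directed $(k,k')$-quasi-geodesics $(\eta_i)_{i=0}^\infty$ in $\Gamma$, one has $\alpha(\mu(\rho(\eta_i)))\ge\kappa i-\kappa'$ for all integers $i\ge0$ and all $\alpha\in\Delta$. *)

theory Defs
  imports "HOL-Analysis.Analysis" "HOL-Algebra.Coset" "HOL-Algebra.Generated_Groups"
begin

text \<open>The vector space is \<^typ>\<open>real ^ 'n\<close>, with no preferred inner product; linear
  automorphisms are given by their matrices.\<close>

definition GL :: "(real ^ 'n ^ 'n) monoid" where
  "GL = \<lparr>carrier = {M. invertible M}, monoid.mult = (**), one = mat 1\<rparr>"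

definition scalars :: "(real ^ 'n ^ 'n) set" where
  "scalars = {mat c | c. c \<noteq> 0}"

definition PGL :: "(real ^ 'n ^ 'n) set monoid" where
  "PGL = GL Mod scalars"


type_synonym 'n form = "real ^ 'n \<Rightarrow> real ^ 'n \<Rightarrow> real"

definition inner_product :: "('n::finite) form \<Rightarrow> bool" where
  "inner_product b \<longleftrightarrow>
     bilinear b \<and> (\<forall>x y. b x y = b y x) \<and> (\<forall>x. x \<noteq> 0 \<longrightarrow> b x x > 0)"

definition scaling_class :: "('n::finite) form \<Rightarrow> 'n form set" where
  "scaling_class b = {(\<lambda>x y. c * b x y) | c. c > 0}"

definition sym_space :: "('n::finite) form set set" where
  "sym_space = {scaling_class b | b. inner_product b}"

definition act :: "(real ^ 'n ^ 'n) set \<Rightarrow> ('n::finite) form set \<Rightarrow> 'n form set" where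
  "act g p = {(\<lambda>x y. b (matrix_inv M *v x) (matrix_inv M *v y)) | M b. M \<in> g \<and> b \<in> p}"


text \<open>The analogue of \<^const>\<open>adjoint\<close> for an arbitrary inner product.\<close>

definition adjoint_wrt :: "('n::finite) form \<Rightarrow> real ^ 'n ^ 'n \<Rightarrow> real ^ 'n ^ 'n" where
  "adjoint_wrt b M = (SOME N. \<forall>x y. b (M *v x) y = b x (N *v y))"

text \<open>The singular values are the nonnegative square roots of the eigenvalues of
  \<open>adjoint_wrt b M ** M\<close>, listed in decreasing order and each repeated according to the
  dimension of its eigenspace (this matrix is diagonalizable, being self-adjoint).\<close>

definition singular_values :: "('n::finite) form \<Rightarrow> real ^ 'n ^ 'n \<Rightarrow> real list" where
  "singular_values b M = (THE xs. sorted_wrt (\<ge>) xs \<and>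
     (\<forall>t. count_list xs t =
        (if t \<ge> 0 then dim {v. (adjoint_wrt b M ** M) *v v = t\<^sup>2 *\<^sub>R v} else 0)))"

text \<open>Neither choice below matters: the matrices of determinant \<open>\<plusminus>1\<close> in a
  class differ by a sign, and rescaling an inner product does not change adjoints. The value is
  the list of coordinates of the Cartan projection, indexed from 0.\<close>

definition cartan :: "('n::finite) form set \<Rightarrow> (real ^ 'n ^ 'n) set \<Rightarrow> real list" where
  "cartan p g = map ln (singular_values (SOME b. b \<in> p) (SOME M. M \<in> g \<and> \<bar>det M\<bar> = 1))"

definition simple_root :: "nat \<Rightarrow> real list \<Rightarrow> real" where
  "simple_root k x = x ! (k - 1) - x ! k"

definition simple_roots :: "nat \<Rightarrow> (real list \<Rightarrow> real) set" where
  "simple_roots n = {simple_root k | k. 1 \<le> k \<and> k \<le> n - 1}"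

definition list_norm :: "real list \<Rightarrow> real" where
  "list_norm x = sqrt (\<Sum>t\<leftarrow>x. t\<^sup>2)"

text \<open>The action on the symmetric space is transitive, so the invariant Riemannian distance is
  determined by its normalization \<open>d(p, g p) = \<parallel>\<mu>(g)\<parallel>\<close> at one point \<open>p\<close>, and by
  invariance the same formula then holds at every point. Lemma \<open>dist_X_act\<close> at the end shows
  that the choice of \<open>g\<close> does not matter, and that the distance is invariant.\<close>

definition dist_X :: "('n::finite) form set \<Rightarrow> 'n form set \<Rightarrow> real" where
  "dist_X p q = list_norm (cartan p (SOME g. g \<in> carrier PGL \<and> act g p = q))"

definition dist_X_set :: "('n::finite) form set \<Rightarrow> 'n form set set \<Rightarrow> real" where
  "dist_X_set p F = (INF q\<in>F. dist_X p q)"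

text \<open>As many lines as the dimension that span the space: their sum is then direct.\<close>

definition line_decomposition :: "(real ^ 'n) set set \<Rightarrow> bool" where
  "line_decomposition Ls \<longleftrightarrow>
     (\<forall>L\<in>Ls. subspace L \<and> dim L = 1) \<and> card Ls = CARD('n) \<and> span (\<Union>Ls) = UNIV"

definition orthogonal_decomposition :: "('n::finite) form \<Rightarrow> (real ^ 'n) set set \<Rightarrow> bool" where
  "orthogonal_decomposition b Ls \<longleftrightarrow>
     (\<forall>L\<in>Ls. \<forall>L'\<in>Ls. L \<noteq> L' \<longrightarrow> (\<forall>u\<in>L. \<forall>v\<in>L'. b u v = 0))"

text \<open>The maximal flats of the symmetric space are the sets of classes of inner products for
  which a fixed decomposition into lines is orthogonal.\<close>

definition maximal_flat :: "('n::finite) form set set \<Rightarrow> bool" where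
  "maximal_flat F \<longleftrightarrow> (\<exists>Ls. line_decomposition Ls \<and>
     F = {p \<in> sym_space. \<forall>b\<in>p. orthogonal_decomposition b Ls})"


definition list_prod :: "('g, 'm) monoid_scheme \<Rightarrow> 'g list \<Rightarrow> 'g" where
  "list_prod G ws = foldr (mult G) ws (one G)"

definition word_length :: "('g, 'm) monoid_scheme \<Rightarrow> 'g set \<Rightarrow> 'g \<Rightarrow> nat" where
  "word_length G S g =
     (LEAST k. \<exists>ws. length ws = k \<and> set ws \<subseteq> S \<union> m_inv G ` S \<and> list_prod G ws = g)"

definition word_dist :: "('g, 'm) monoid_scheme \<Rightarrow> 'g set \<Rightarrow> 'g \<Rightarrow> 'g \<Rightarrow> nat" where
  "word_dist G S g h = word_length G S (inv\<^bsub>G\<^esub> g \<otimes>\<^bsub>G\<^esub> h)"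

definition quasi_geodesic ::
    "('g, 'm) monoid_scheme \<Rightarrow> 'g set \<Rightarrow> real \<Rightarrow> real \<Rightarrow> (nat \<Rightarrow> 'g) \<Rightarrow> bool" where
  "quasi_geodesic G S k k' \<eta> \<longleftrightarrow> (\<forall>i j.
     1 / k * \<bar>real i - real j\<bar> - k' \<le> real (word_dist G S (\<eta> i) (\<eta> j)) \<and>
     real (word_dist G S (\<eta> i) (\<eta> j)) \<le> k * \<bar>real i - real j\<bar> + k')"

text \<open>Rays are indexed from 1; the value at 0 is irrelevant.\<close>

definition directed_ray :: "'a set \<Rightarrow> ('a \<times> 'a) set \<Rightarrow> (nat \<Rightarrow> 'a) \<Rightarrow> bool" where
  "directed_ray A B p \<longleftrightarrow> (\<forall>i>0. p i \<in> A \<and> (p i, p (Suc i)) \<in> B)"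

definition directed_seq :: "('g, 'm) monoid_scheme \<Rightarrow> 'a set \<Rightarrow> ('a \<times> 'a) set \<Rightarrow> ('a \<Rightarrow> 'g)
    \<Rightarrow> (nat \<Rightarrow> 'g) \<Rightarrow> bool" where
  "directed_seq G A B R \<eta> \<longleftrightarrow> \<eta> 0 = \<one>\<^bsub>G\<^esub> \<and> (\<exists>p. directed_ray A B p \<and>
     (\<forall>i>0. \<eta> i = list_prod G (map (\<lambda>j. R (p j)) [1..<Suc i])))"

definition directed_anosov :: "('g, 'm) monoid_scheme \<Rightarrow> 'g set \<Rightarrow> 'a set \<Rightarrow> ('a \<times> 'a) set
    \<Rightarrow> ('a \<Rightarrow> 'g) \<Rightarrow> ('n::finite) form set \<Rightarrow> ('g \<Rightarrow> (real ^ 'n ^ 'n) set) \<Rightarrow> bool" where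
  "directed_anosov G S A B R x\<^sub>0 \<rho> \<longleftrightarrow> (\<forall>k>0. \<forall>k'>0. \<exists>\<kappa>>0. \<exists>\<kappa>'>0.
     \<forall>\<eta>. directed_seq G A B R \<eta> \<and> quasi_geodesic G S k k' \<eta> \<longrightarrow>
       (\<forall>i. \<forall>\<alpha>\<in>simple_roots CARD('n). \<alpha> (cartan x\<^sub>0 (\<rho> (\<eta> i))) \<ge> \<kappa> * real i - \<kappa>'))"


text \<open>Independence of \<^const>\<open>dist_X\<close> from choices, its normalization and its
  invariance: \<open>d(h p, h g p) = \<parallel>\<mu>(g)\<parallel>\<close>.\<close>

lemma inner_product_smult:
  assumes "inner_product b" "c > 0"
  shows "inner_product (\<lambda>x y. c * b x y)"
  using assms unfolding inner_product_def bilinear_def linear_iff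
  by (auto simp: algebra_simps)

lemma matrix_inv_works:
  assumes "invertible (M :: real ^ 'n ^ 'n)"
  shows "M ** matrix_inv M = mat 1" "matrix_inv M ** M = mat 1"
  using someI_ex[OF assms[unfolded invertible_def]] by (auto simp: matrix_inv_def)

lemma matrix_inv_works':
  assumes "invertible (M :: real ^ 'n ^ 'n)"
  shows "M *v (matrix_inv M *v z) = z" "matrix_inv M *v (M *v z) = z"
  using matrix_inv_works[OF assms] by (simp_all add: matrix_vector_mul_assoc)

lemma matrix_inv_eqI:
  assumes "N ** M = mat 1"
  shows "matrix_inv (M :: real ^ 'n ^ 'n) = N"
  by (metis assms invertible_left_inverse matrix_inv_works(1) matrix_mul_assoc matrix_mul_lid
      matrix_mul_rid)

lemma invertible_matrix_inv:
  "invertible (M :: real ^ 'n ^ 'n) \<Longrightarrow> invertible (matrix_inv M)"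
  using matrix_inv_works invertible_def by blast

lemma gram:
  fixes b :: "('n::finite) form"
  assumes "inner_product b"
  obtains G where "invertible G" "\<And>x y. b x y = x \<bullet> (G *v y)"
proof -
  have bl: "bilinear b" and pos: "\<And>x. x \<noteq> 0 \<Longrightarrow> b x x > 0"
    using assms by (auto simp: inner_product_def)
  define f where "f y = (\<chi> i. b (axis i 1) y)" for y
  have "linear f"
    using bl unfolding bilinear_def linear_iff f_def by (simp add: vec_eq_iff)
  then have G: "matrix f *v y = f y" for y by (simp add: matrix_works)
  have b: "b x y = x \<bullet> (matrix f *v y)" for x y
  proof -
    have lin: "linear (\<lambda>x. b x y)" using bl by (simp add: bilinear_def)
    have "b x y = b (\<Sum>i\<in>UNIV. x $ i *\<^sub>R axis i 1) y"
      using basis_expansion[of x] by (simp add: scalar_mult_eq_scaleR)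
    also have "\<dots> = (\<Sum>i\<in>UNIV. x $ i * b (axis i 1) y)"
      by (subst linear_sum[OF lin]) (simp add: linear_scale[OF lin])
    also have "\<dots> = x \<bullet> f y" by (simp add: f_def inner_vec_def)
    finally show ?thesis by (simp add: G)
  qed
  have "y = 0" if "matrix f *v y = 0" for y
    using b[of y y] pos[of y] that by force
  then have "invertible (matrix f)"
    by (simp add: invertible_left_inverse matrix_left_invertible_ker)
  with b that show thesis by blast
qed

lemma adjoint_wrt_works:
  fixes b :: "('n::finite) form"
  assumes "inner_product b"
  shows "b (M *v x) y = b x (adjoint_wrt b M *v y)"
proof -
  obtain G where G: "invertible G" "\<And>x y. b x y = x \<bullet> (G *v y)"
    using gram[OF assms] by blast
  have "G *v (matrix_inv G *v z) = z" for z
    using matrix_inv_works'[OF G(1)] by simp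
  then have "\<forall>x y. b (M *v x) y = b x ((matrix_inv G ** transpose M ** G) *v y)"
    by (simp add: G(2) dot_lmul_matrix matrix_vector_mul_assoc[symmetric])
       (metis dot_lmul_matrix inner_commute transpose_matrix_vector)
  then have "\<exists>N. \<forall>x y. b (M *v x) y = b x (N *v y)" by blast
  from someI_ex[OF this] show ?thesis unfolding adjoint_wrt_def by blast
qed

lemma eigen_iff:
  fixes b :: "('n::finite) form"
  assumes "inner_product b"
  shows "(adjoint_wrt b M ** M) *v v = s *\<^sub>R v \<longleftrightarrow> (\<forall>w. b (M *v w) (M *v v) = s * b w v)"
proof -
  have bl: "bilinear b" and pos: "\<And>x. x \<noteq> 0 \<Longrightarrow> b x x > 0"
    using assms by (auto simp: inner_product_def)
  have diff: "b w (x - y) = b w x - b w y" and sc: "b w (s *\<^sub>R y) = s * b w y" for w x y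
    using bl by (simp_all add: bilinear_rsub bilinear_rmul)
  have "x = y" if "\<forall>w. b w x = b w y" for x y
    using that pos[of "x - y"] diff[of "x - y" x y] by force
  then have "(adjoint_wrt b M ** M) *v v = s *\<^sub>R v \<longleftrightarrow>
      (\<forall>w. b w ((adjoint_wrt b M ** M) *v v) = b w (s *\<^sub>R v))" by metis
  also have "\<dots> \<longleftrightarrow> (\<forall>w. b (M *v w) (M *v v) = s * b w v)"
    by (simp add: sc adjoint_wrt_works[OF assms] matrix_vector_mul_assoc)
  finally show ?thesis .
qed

lemma singular_values_transport:
  fixes b b' :: "('n::finite) form"
  assumes b: "inner_product b" "inner_product b'" and P: "invertible P" and "c > 0"
    and M: "\<And>v w. b' (M' *v (P *v v)) (M' *v (P *v w)) = c * b (M *v v) (M *v w)"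
    and id: "\<And>v w. b' (P *v v) (P *v w) = c * b v w"
  shows "singular_values b' M' = singular_values b M"
proof -
  have PQ: "P *v (matrix_inv P *v z) = z" "matrix_inv P *v (P *v z) = z" for z
    using matrix_inv_works'[OF P] by simp_all
  let ?E = "\<lambda>b M s. {v. (adjoint_wrt b M ** M) *v v = s *\<^sub>R v}"
  have iff: "P *v v \<in> ?E b' M' s \<longleftrightarrow> v \<in> ?E b M s" for v s
  proof -
    have "P *v v \<in> ?E b' M' s \<longleftrightarrow>
        (\<forall>w. b' (M' *v (P *v w)) (M' *v (P *v v)) = s * b' (P *v w) (P *v v))"
      using PQ by (simp add: eigen_iff[OF b(2)]) metis
    then show ?thesis using \<open>c > 0\<close> by (simp add: M id eigen_iff[OF b(1)])
  qed
  have "?E b' M' s = (*v) P ` ?E b M s" for s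
  proof (intro equalityI subsetI)
    fix u assume "u \<in> ?E b' M' s"
    then have "P *v (matrix_inv P *v u) \<in> ?E b' M' s" unfolding PQ(1) .
    then have "matrix_inv P *v u \<in> ?E b M s" by (rule iff[THEN iffD1])
    then have "P *v (matrix_inv P *v u) \<in> (*v) P ` ?E b M s" by (rule imageI)
    then show "u \<in> (*v) P ` ?E b M s" unfolding PQ(1) .
  next
    fix u assume "u \<in> (*v) P ` ?E b M s"
    then show "u \<in> ?E b' M' s" by (rule imageE) (simp only: iff)
  qed
  moreover have "inj ((*v) P)" by (metis PQ(2) injI)
  ultimately have "dim (?E b' M' s) = dim (?E b M s)" for s
    by (simp add: dim_image_eq inj_on_subset)
  then show ?thesis unfolding singular_values_def by simp
qed

lemma mat_mult: "mat c ** M = c *\<^sub>R (M :: real ^ 'n ^ 'n)"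
proof -
  have "mat c = c *\<^sub>R (mat 1 :: real ^ 'n ^ 'n)" by (simp add: mat_def vec_eq_iff)
  then show ?thesis by (metis matrix_mul_lid scalar_matrix_assoc)
qed

lemma det_scaleR: "det (c *\<^sub>R M) = c ^ CARD('n) * det (M :: real ^ 'n ^ 'n)"
proof -
  have "det (mat c :: real ^ 'n ^ 'n) = c ^ CARD('n)" by (simp add: det_diagonal mat_def)
  then show ?thesis by (metis det_mul mat_mult)
qed

lemma carrier_PGL:
  "carrier PGL = {{c *\<^sub>R M | c. c \<noteq> 0} | M. invertible (M :: real ^ 'n ^ 'n)}"
proof -
  have "scalars #>\<^bsub>GL\<^esub> M = {c *\<^sub>R M | c. c \<noteq> 0}" for M :: "real ^ 'n ^ 'n"
    unfolding r_coset_def scalars_def GL_def by (auto simp: mat_mult[symmetric])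
  then show ?thesis by (auto simp: PGL_def FactGroup_def RCOSETS_def GL_def)
qed

lemma mult_PGL:
  "{c *\<^sub>R M | c. c \<noteq> 0} \<otimes>\<^bsub>PGL\<^esub> {c *\<^sub>R N | c. c \<noteq> 0} =
    {c *\<^sub>R (M ** N :: real ^ 'n ^ 'n) | c. c \<noteq> 0}" (is "?L = ?R")
proof -
  have eq: "(c *\<^sub>R M) ** (d *\<^sub>R N) = (c * d) *\<^sub>R (M ** N)" for c d
    by (simp add: matrix_scalar_ac scalar_matrix_assoc[symmetric])
  have "c *\<^sub>R (M ** N) \<in> ?L" if "c \<noteq> 0" for c
    using that eq[of c 1] unfolding PGL_def FactGroup_def set_mult_def GL_def
    by simp (metis scaleR_one zero_neq_one)
  moreover have "?L \<subseteq> ?R"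
    unfolding PGL_def FactGroup_def set_mult_def GL_def by (auto simp: eq)
  ultimately show ?thesis by blast
qed

lemma PGL_rep:
  assumes "g \<in> carrier PGL"
  obtains M :: "real ^ 'n ^ 'n"
    where "invertible M" "\<bar>det M\<bar> = 1" "g = {c *\<^sub>R M | c. c \<noteq> 0}"
proof -
  obtain M :: "real ^ 'n ^ 'n" where M: "invertible M" "g = {c *\<^sub>R M | c. c \<noteq> 0}"
    using assms by (auto simp: carrier_PGL)
  define d where "d = root CARD('n) (1 / \<bar>det M\<bar>)"
  have "det M \<noteq> 0" using M(1) by (simp add: invertible_det_nz)
  then have d: "d > 0" "d ^ CARD('n) = 1 / \<bar>det M\<bar>" by (simp_all add: d_def)
  with \<open>det M \<noteq> 0\<close> have det: "\<bar>det (d *\<^sub>R M)\<bar> = 1"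
    by (simp add: det_scaleR abs_mult)
  then have "invertible (d *\<^sub>R M)" using invertible_det_nz by force
  moreover have "g = {c *\<^sub>R (d *\<^sub>R M) | c. c \<noteq> 0}"
    using d(1) unfolding M(2)
    by auto (metis divide_eq_0_iff less_irrefl nonzero_eq_divide_eq)
  ultimately show thesis using det that by blast
qed

lemma act_rep:
  assumes M: "invertible (M :: real ^ 'n ^ 'n)" and bl: "bilinear b"
  shows "act {c *\<^sub>R M | c. c \<noteq> 0} (scaling_class b) =
    scaling_class (\<lambda>x y. b (matrix_inv M *v x) (matrix_inv M *v y))"
proof -
  have "matrix_inv (c *\<^sub>R M) = (1 / c) *\<^sub>R matrix_inv M" if "c \<noteq> 0" for c
    using that matrix_inv_works[OF M]
    by (intro matrix_inv_eqI) (simp add: matrix_scalar_ac scalar_matrix_assoc[symmetric])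
  then have inv: "d * b (matrix_inv (c *\<^sub>R M) *v x) (matrix_inv (c *\<^sub>R M) *v y) =
      (d / c\<^sup>2) * b (matrix_inv M *v x) (matrix_inv M *v y)" if "c \<noteq> 0" for c d x y
    using that bl
    by (simp add: scaleR_matrix_vector_assoc[symmetric] bilinear_lmul bilinear_rmul
        power2_eq_square)
  show ?thesis
  proof (intro equalityI subsetI)
    fix f assume "f \<in> act {c *\<^sub>R M | c. c \<noteq> 0} (scaling_class b)"
    then obtain c d where cd: "c \<noteq> 0" "d > 0"
      "f = (\<lambda>x y. d * b (matrix_inv (c *\<^sub>R M) *v x) (matrix_inv (c *\<^sub>R M) *v y))"
      by (auto simp: act_def scaling_class_def)
    then have "f = (\<lambda>x y. (d / c\<^sup>2) * b (matrix_inv M *v x) (matrix_inv M *v y))" "d / c\<^sup>2 > 0"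
      using inv by auto
    then show "f \<in> scaling_class (\<lambda>x y. b (matrix_inv M *v x) (matrix_inv M *v y))"
      unfolding scaling_class_def by blast
  next
    fix f assume "f \<in> scaling_class (\<lambda>x y. b (matrix_inv M *v x) (matrix_inv M *v y))"
    then obtain d where d: "d > 0" "f = (\<lambda>x y. d * b (matrix_inv M *v x) (matrix_inv M *v y))"
      by (auto simp: scaling_class_def)
    define b' where "b' = (\<lambda>x y. d * b x y)"
    have "f = (\<lambda>x y. b' (matrix_inv M *v x) (matrix_inv M *v y))" using d by (simp add: b'_def)
    moreover have "M \<in> {c *\<^sub>R M | c. c \<noteq> 0}" by (auto intro: exI[of _ 1])
    moreover have "b' \<in> scaling_class b" using d unfolding scaling_class_def b'_def by blast
    ultimately show "f \<in> act {c *\<^sub>R M | c. c \<noteq> 0} (scaling_class b)"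
      unfolding act_def by blast
  qed
qed

lemma inner_product_act:
  assumes "inner_product b" "invertible (N :: real ^ 'n ^ 'n)"
  shows "inner_product (\<lambda>x y. b (N *v x) (N *v y))"
proof -
  have "N *v x \<noteq> 0" if "x \<noteq> 0" for x
    using that matrix_inv_works'(2)[OF assms(2)] by (metis matrix_vector_mult_0_right)
  then show ?thesis
    using assms(1) unfolding inner_product_def bilinear_def linear_iff
    by (simp add: matrix_vector_right_distrib matrix_vector_mult_scaleR)
qed

lemma cartan_eq:
  fixes b :: "('n::finite) form"
  assumes b: "inner_product b" and M: "invertible M" "\<bar>det M\<bar> = 1"
  shows "cartan (scaling_class b) {c *\<^sub>R M | c. c \<noteq> 0} = map ln (singular_values b M)"
proof -
  define b' where "b' = (SOME b'. b' \<in> scaling_class b)"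
  define M' where "M' = (SOME M'. M' \<in> {c *\<^sub>R M | c. c \<noteq> 0} \<and> \<bar>det M'\<bar> = 1)"
  have "b \<in> scaling_class b" by (auto simp: scaling_class_def intro!: exI[of _ 1])
  then have "b' \<in> scaling_class b" unfolding b'_def by (metis someI_ex)
  then obtain c where c: "c > 0" "b' = (\<lambda>x y. c * b x y)" by (auto simp: scaling_class_def)
  have bl: "bilinear b" using b by (simp add: inner_product_def)
  have "M \<in> {c *\<^sub>R M | c. c \<noteq> 0} \<and> \<bar>det M\<bar> = 1"
    using M by (auto intro: exI[of _ 1])
  then have "M' \<in> {c *\<^sub>R M | c. c \<noteq> 0} \<and> \<bar>det M'\<bar> = 1" unfolding M'_def by (rule someI[where x = M])
  then obtain d where d: "M' = d *\<^sub>R M" "\<bar>det (d *\<^sub>R M)\<bar> = 1" by auto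
  then have "\<bar>d\<bar> ^ CARD('n) = 1" using M by (simp add: det_scaleR abs_mult power_abs)
  then have "\<bar>d\<bar> = 1" using power_eq_imp_eq_base[of "\<bar>d\<bar>" "CARD('n)" 1] by simp
  then have "d * d = 1" by (metis abs_mult_self_eq mult_1)
  then have "singular_values b' M' = singular_values b M"
  proof (intro singular_values_transport[where P = "mat 1" and c = c])
    show "inner_product b'" unfolding c(2) by (rule inner_product_smult[OF b c(1)])
    have "b (M' *v v) (M' *v w) = (d * d) * b (M *v v) (M *v w)" for v w
      unfolding d(1) scaleR_matrix_vector_assoc[symmetric]
      by (simp only: bilinear_lmul[OF bl] bilinear_rmul[OF bl] real_scaleR_def mult.assoc)
    then show "b' (M' *v (mat 1 *v v)) (M' *v (mat 1 *v w)) = c * b (M *v v) (M *v w)" for v w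
      using \<open>d * d = 1\<close> by (simp add: c(2))
    show "invertible (mat 1 :: real ^ 'n ^ 'n)" by (auto simp: invertible_def)
  qed (use b c in simp_all)
  then show ?thesis unfolding cartan_def b'_def M'_def by simp
qed

lemma singular_values_coset:
  fixes b :: "('n::finite) form"
  assumes b: "inner_product b"
    and MN: "invertible M" "\<bar>det M\<bar> = 1" "invertible N" "\<bar>det N\<bar> = 1"
    and eq: "scaling_class (\<lambda>x y. b (matrix_inv M *v x) (matrix_inv M *v y)) =
      scaling_class (\<lambda>x y. b (matrix_inv N *v x) (matrix_inv N *v y))"
  shows "singular_values b M = singular_values b N"
proof -
  have "(\<lambda>x y. b (matrix_inv M *v x) (matrix_inv M *v y)) \<in>
      scaling_class (\<lambda>x y. b (matrix_inv M *v x) (matrix_inv M *v y))"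
    by (auto simp: scaling_class_def intro!: exI[of _ 1])
  then obtain c where c: "c > 0"
    "\<And>x y. b (matrix_inv M *v x) (matrix_inv M *v y) =
       c * b (matrix_inv N *v x) (matrix_inv N *v y)"
    unfolding eq by (auto simp: scaling_class_def fun_eq_iff)
  define P where "P = matrix_inv N ** M"
  have P: "invertible P" unfolding P_def by (intro invertible_mult invertible_matrix_inv MN)
  have "N ** P = M" unfolding P_def using matrix_inv_works[OF MN(3)] by (simp add: matrix_mul_assoc)
  then have NP: "N *v (P *v v) = M *v v" and detP: "\<bar>det P\<bar> = 1" for v
    using MN by (auto simp: matrix_vector_mul_assoc det_mul abs_mult)
  have bP: "b v w = c * b (P *v v) (P *v w)" for v w
    using c(2)[of "M *v v" "M *v w"] matrix_inv_works'[OF MN(1)]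
    by (simp add: P_def matrix_vector_mul_assoc[symmetric])
  obtain G where G: "invertible G" "\<And>x y. b x y = x \<bullet> (G *v y)"
    using gram[OF b] by blast
  have "v \<bullet> (G *v w) = v \<bullet> ((c *\<^sub>R (transpose P ** G ** P)) *v w)" for v w
  proof -
    have "v \<bullet> ((transpose P ** G ** P) *v w) = (P *v v) \<bullet> (G *v (P *v w))"
      by (metis dot_lmul_matrix matrix_vector_mul_assoc vector_transpose_matrix)
    then show ?thesis using bP[of v w]
      by (simp add: G scaleR_matrix_vector_assoc[symmetric])
  qed
  then have "G = c *\<^sub>R (transpose P ** G ** P)"
    by (metis matrix_eq vector_eq_ldot)
  then have "det G = det (c *\<^sub>R (transpose P ** G ** P))" by (rule arg_cong)
  also have "\<dots> = c ^ CARD('n) * (det P * det P) * det G"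
    by (simp add: det_scaleR det_mul)
  finally have "det G = c ^ CARD('n) * (det P * det P) * det G" .
  moreover have "det P * det P = 1" using detP by (metis abs_mult_self_eq mult_1)
  moreover have "det G \<noteq> 0" using G by (simp add: invertible_det_nz)
  ultimately have "c ^ CARD('n) = 1" by simp
  then have "c = 1" using c(1) power_eq_imp_eq_base[of c "CARD('n)" 1] by simp
  then have "b (P *v v) (P *v w) = 1 * b v w" for v w using bP[of v w] by simp
  then show ?thesis
    by (intro singular_values_transport[OF b b P, of 1 N M, symmetric]) (simp_all only: NP mult_1 zero_less_one)
qed

lemma dist_X_act:
  fixes p :: "('n::finite) form set"
  assumes p: "p \<in> sym_space" and g: "g \<in> carrier PGL" and h: "h \<in> carrier PGL"
  shows "dist_X (act h p) (act (h \<otimes>\<^bsub>PGL\<^esub> g) p) = list_norm (cartan p g)"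
proof -
  obtain b where b: "inner_product b" "p = scaling_class b" using p by (auto simp: sym_space_def)
  obtain G where G: "invertible G" "\<bar>det G\<bar> = 1" "g = {c *\<^sub>R G | c. c \<noteq> 0}"
    using PGL_rep[OF g] by blast
  obtain H where H: "invertible H" "\<bar>det H\<bar> = 1" "h = {c *\<^sub>R H | c. c \<noteq> 0}"
    using PGL_rep[OF h] by blast
  define b' where "b' = (\<lambda>x y. b (matrix_inv H *v x) (matrix_inv H *v y))"
  have b': "inner_product b'"
    unfolding b'_def using b H by (intro inner_product_act invertible_matrix_inv)
  have bl: "bilinear b" "bilinear b'" using b b' by (auto simp: inner_product_def)
  define K where "K = H ** G ** matrix_inv H"
  have K: "invertible K" unfolding K_def using G H by (intro invertible_mult invertible_matrix_inv)
  have "det H * det (matrix_inv H) = 1" using matrix_inv_works(1)[OF H(1)] by (metis det_I det_mul)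
  then have detK: "\<bar>det K\<bar> = 1" unfolding K_def using G H by (simp add: det_mul mult.commute mult.left_commute)
  have HG: "matrix_inv (H ** G) = matrix_inv G ** matrix_inv H"
  proof (rule matrix_inv_eqI)
    have "matrix_inv G ** matrix_inv H ** (H ** G) = matrix_inv G ** (matrix_inv H ** H) ** G"
      by (simp only: matrix_mul_assoc)
    then show "matrix_inv G ** matrix_inv H ** (H ** G) = mat 1"
      by (simp add: matrix_inv_works G H)
  qed
  have Ki: "matrix_inv K = H ** matrix_inv G ** matrix_inv H"
  proof (rule matrix_inv_eqI)
    have "H ** matrix_inv G ** matrix_inv H ** K =
        H ** (matrix_inv G ** (matrix_inv H ** H) ** G) ** matrix_inv H"
      by (simp only: K_def matrix_mul_assoc)
    then show "H ** matrix_inv G ** matrix_inv H ** K = mat 1"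
      by (simp add: matrix_inv_works G H)
  qed
  have hp: "act h p = scaling_class b'"
    unfolding b(2) H(3) b'_def by (rule act_rep[OF H(1) bl(1)])
  have "act (h \<otimes>\<^bsub>PGL\<^esub> g) p =
      scaling_class (\<lambda>x y. b (matrix_inv (H ** G) *v x) (matrix_inv (H ** G) *v y))"
    unfolding b(2) H(3) G(3) mult_PGL
    by (rule act_rep[OF invertible_mult[OF H(1) G(1)] bl(1)])
  also have "\<dots> = scaling_class (\<lambda>x y. b' (matrix_inv K *v x) (matrix_inv K *v y))"
    by (simp add: b'_def HG Ki matrix_vector_mul_assoc[symmetric] matrix_inv_works'[OF H(1)])
  finally have hgp: "act (h \<otimes>\<^bsub>PGL\<^esub> g) p =
      scaling_class (\<lambda>x y. b' (matrix_inv K *v x) (matrix_inv K *v y))" .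
  define k where "k = (SOME k. k \<in> carrier PGL \<and> act k (act h p) = act (h \<otimes>\<^bsub>PGL\<^esub> g) p)"
  have "{c *\<^sub>R K | c. c \<noteq> 0} \<in> carrier PGL \<and>
      act {c *\<^sub>R K | c. c \<noteq> 0} (act h p) = act (h \<otimes>\<^bsub>PGL\<^esub> g) p"
    unfolding hgp hp using K act_rep[OF K bl(2)] by (auto simp: carrier_PGL)
  then have k: "k \<in> carrier PGL" "act k (act h p) = act (h \<otimes>\<^bsub>PGL\<^esub> g) p"
    unfolding k_def by (metis (mono_tags, lifting) someI)+
  obtain L where L: "invertible L" "\<bar>det L\<bar> = 1" "k = {c *\<^sub>R L | c. c \<noteq> 0}"
    using PGL_rep[OF k(1)] by blast
  have "singular_values b' L = singular_values b' K"
    using k(2) unfolding hgp hp L(3) act_rep[OF L(1) bl(2)]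
    by (intro singular_values_coset b' L K detK) 
  also have "\<dots> = singular_values b G"
    by (rule singular_values_transport[OF b(1) b' H(1), of 1])
       (simp_all add: b'_def K_def matrix_vector_mul_assoc[symmetric] matrix_inv_works'[OF H(1)])
  finally have "cartan (act h p) k = cartan p g"
    unfolding hp unfolding b(2) L(3) G(3) cartan_eq[OF b' L(1,2)] cartan_eq[OF b(1) G(1,2)] by simp
  then show ?thesis unfolding dist_X_def k_def by simp
qed

end

theory Submission
  imports Defs
begin

text \<open>Along a directed sequence \<open>\<eta>\<close> the points \<open>\<rho>(\<eta> i) o\<close> stay at distance at most \<open>C\<close> from one flat. A flat
  has coordinates \<open>X i a\<close>, one for each of the lines that define it, and the Cartan projection of
  \<open>\<rho>(inv (\<eta> i) \<eta> j)\<close> is, up to a bounded error and an additive constant, the decreasing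
  rearrangement of the vector \<open>X j - X i\<close> (lemma \<open>flat_coordinates\<close>). Its simple roots are
  therefore, up to a bounded error, absolute values of differences
  \<open>(X j a - X j c) - (X i a - X i c)\<close> with \<open>a \<noteq> c\<close>.

  Fix \<open>a \<noteq> c\<close> and put \<open>z i = X i a - X i c\<close>. The element \<open>inv (\<eta> i) \<eta> (i + l)\<close> is itself the \<open>l\<close>-th
  term of a directed sequence (lemma \<open>directed_seq_tail\<close>). With \<open>l = 1\<close>, finiteness of the graph
  bounds \<open>\<bar>z (i + 1) - z i\<bar>\<close> by a constant \<open>D\<close>. Divergence of the simple roots is uniform in the
  directed sequence (lemma \<open>uniform_divergence\<close>), so some \<open>N\<close> satisfies
  \<open>\<bar>z (i + N) - z i\<bar> \<ge> T > D\<close> for all \<open>i\<close>. When \<open>i\<close> moves by one, the increment \<open>z (i + N) - z i\<close> moves by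
  less than \<open>2 * T\<close>, so it never changes sign. The increments over consecutive blocks of length \<open>N\<close>
  add up, and \<open>\<bar>z i - z 0\<bar>\<close> grows at least linearly (lemma \<open>linear_escape\<close>). Read back through the
  coordinates, the simple roots of \<open>\<mu>(\<rho>(\<eta> i))\<close> grow linearly, with constants that depend only on
  \<open>C\<close>, \<open>D\<close>, \<open>N\<close> and \<open>T\<close>.

  The comparison with coordinates rests on simultaneous diagonalisation. The gaps of the Cartan
  projection of \<open>h\<close> are half the differences of the logarithms of the eigenvalues of one inner
  product relative to another, these representing \<open>g o\<close> and \<open>g h o\<close> (lemma \<open>cartan_gap\<close>). Bounded
  distance in the symmetric space means that the quadratic forms are comparable up to a factor
  (lemma \<open>dist_X_comparable\<close>), and the Courant--Fischer principle shows that replacing forms by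
  comparable ones changes the logarithms of the eigenvalues by a bounded amount. For two inner
  products in the flat, which share an orthogonal basis, the eigenvalues are the ratios of their
  values on that basis.\<close>


section \<open>Orthogonal systems\<close>

lemma orthogonal_form_sum:
  assumes "bilinear b" "finite I"
    and orth: "\<And>i j. i \<in> I \<Longrightarrow> j \<in> I \<Longrightarrow> i \<noteq> j \<Longrightarrow> b (e i) (e j) = 0"
  shows "b (\<Sum>i\<in>I. c i *\<^sub>R e i) (\<Sum>i\<in>I. d i *\<^sub>R e i) = (\<Sum>i\<in>I. c i * d i * b (e i) (e i) :: real)"
proof -
  have "b (\<Sum>i\<in>I. c i *\<^sub>R e i) (\<Sum>i\<in>I. d i *\<^sub>R e i) =
      (\<Sum>i\<in>I. \<Sum>j\<in>I. b (c i *\<^sub>R e i) (d j *\<^sub>R e j))"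
    using assms by (simp add: bilinear_sum sum.cartesian_product)
  also have "\<dots> = (\<Sum>i\<in>I. \<Sum>j\<in>I. if j = i then c i * d i * b (e i) (e i) else 0)"
    using orth by (intro sum.cong refl) (auto simp: bilinear_lmul[OF assms(1)] bilinear_rmul[OF assms(1)])
  finally show ?thesis using assms(2) by simp
qed

text \<open>Orthogonality for an inner product replaces a change of basis: it gives linear independence and
  hence the dimension of a span, for index sets of any type.\<close>

lemma orthogonal_system:
  fixes e :: "'i \<Rightarrow> real ^ 'n"
  assumes b: "inner_product b" and I: "finite I"
    and orth: "\<And>i j. i \<in> I \<Longrightarrow> j \<in> I \<Longrightarrow> i \<noteq> j \<Longrightarrow> b (e i) (e j) = 0"
    and nz: "\<And>i. i \<in> I \<Longrightarrow> e i \<noteq> 0"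
  shows "inj_on e I" and "independent (e ` I)" and "dim (span (e ` I)) = card I"
    and "w \<in> span (e ` I) \<Longrightarrow> \<exists>c. w = (\<Sum>i\<in>I. c i *\<^sub>R e i)"
proof -
  have bl: "bilinear b" and pos: "\<And>x. x \<noteq> 0 \<Longrightarrow> b x x > 0"
    using b by (auto simp: inner_product_def)
  show inj: "inj_on e I"
    using orth nz pos by (intro inj_onI) (metis less_irrefl)
  show ind: "independent (e ` I)"
  proof (rule independent_if_scalars_zero)
    fix f x assume f: "(\<Sum>x\<in>e ` I. f x *\<^sub>R x) = 0" and "x \<in> e ` I"
    then obtain i where i: "i \<in> I" "x = e i" by auto
    have "b (\<Sum>j\<in>I. f (e j) *\<^sub>R e j) (\<Sum>j\<in>I. (if j = i then 1 else 0) *\<^sub>R e j) = 0"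
      using f by (simp add: sum.reindex[OF inj] bilinear_lzero[OF bl])
    moreover have "b (\<Sum>j\<in>I. f (e j) *\<^sub>R e j) (\<Sum>j\<in>I. (if j = i then 1 else 0) *\<^sub>R e j) =
        (\<Sum>j\<in>I. f (e j) * (if j = i then 1 else 0) * b (e j) (e j))"
      by (rule orthogonal_form_sum[OF bl I orth])
    moreover have "\<dots> = (\<Sum>j\<in>I. if j = i then f (e i) * b (e i) (e i) else 0)"
      by (intro sum.cong) auto
    ultimately have "(\<Sum>j\<in>I. if j = i then f (e i) * b (e i) (e i) else 0) = 0" by simp
    then have "f (e i) * b (e i) (e i) = 0" using I i by simp
    then show "f x = 0" using pos[OF nz[OF i(1)]] i by simp
  qed (use I in simp)
  show "dim (span (e ` I)) = card I"
    using dim_span_eq_card_independent[OF ind] by (simp only: card_image[OF inj])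
  show "\<exists>c. w = (\<Sum>i\<in>I. c i *\<^sub>R e i)" if w: "w \<in> span (e ` I)"
  proof -
    obtain f where "w = (\<Sum>v\<in>e ` I. f v *\<^sub>R v)" using w I by (auto simp: span_finite)
    then show ?thesis by (auto simp: sum.reindex[OF inj])
  qed
qed


section \<open>Simultaneous diagonalisation of two forms\<close>

text \<open>The basis is indexed by an initial segment of the naturals, so that the condition that the
  eigenvalues \<open>l\<close> decrease matches the order of singular values.\<close>

definition diagonalises ::
    "('n::finite) form \<Rightarrow> 'n form \<Rightarrow> (nat \<Rightarrow> real ^ 'n) \<Rightarrow> (nat \<Rightarrow> real) \<Rightarrow> nat \<Rightarrow> bool" where
  "diagonalises b q e l m \<longleftrightarrow>
     (\<forall>i<m. \<forall>j<m. b (e i) (e j) = (if i = j then 1 else 0)) \<and>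
     (\<forall>i<m. \<forall>j<m. q (e i) (e j) = (if i = j then l i else 0)) \<and>
     (\<forall>i j. i \<le> j \<longrightarrow> j < m \<longrightarrow> l j \<le> l i)"

text \<open>A maximum of the Rayleigh quotient exists by compactness; it is the top eigenvector of \<open>q\<close>
  relative to \<open>b\<close>.\<close>

lemma rayleigh_maximiser:
  fixes b q :: "('n::finite) form"
  assumes b: "inner_product b" and q: "bilinear q" and W: "subspace W" "dim W > 0"
  obtains e where "e \<in> W" "b e e = 1" "\<And>w. w \<in> W \<Longrightarrow> q w w \<le> q e e * b w w"
proof -
  have bl: "bilinear b" and pos: "\<And>x. x \<noteq> 0 \<Longrightarrow> b x x > 0"
    using b by (auto simp: inner_product_def)
  \<comment> \<open>The quotient is maximised over the Euclidean unit sphere, whose compactness is known; the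
    maximiser is then rescaled to a \<open>b\<close>-unit vector.\<close>
  define K where "K = W \<inter> sphere 0 1"
  have "compact K" unfolding K_def
    by (simp add: closed_Int_compact closed_subspace[OF W(1)])
  obtain v where v: "v \<in> W" "v \<noteq> 0" using W by (metis dim_eq_0 less_irrefl subset_iff singletonI)
  then have "(1 / norm v) *\<^sub>R v \<in> K"
    unfolding K_def using W(1) by (simp add: subspace_mul)
  then have "K \<noteq> {}" by auto
  have K: "x \<noteq> 0" if "x \<in> K" for x using that by (auto simp: K_def)
  have "continuous_on K (\<lambda>x. q x x / b x x)"
  proof (rule continuous_on_divide)
    have *: "continuous_on K (\<lambda>x. f x x)" if "bilinear f" for f :: "'n form"
      by (rule bilinear_continuous_on_compose[OF continuous_on_id continuous_on_id that])
    show "continuous_on K (\<lambda>x. q x x)" "continuous_on K (\<lambda>x. b x x)" by (rule *[OF q] *[OF bl])+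
    show "\<forall>x\<in>K. b x x \<noteq> 0" using pos K by force
  qed
  from continuous_attains_sup[OF \<open>compact K\<close> \<open>K \<noteq> {}\<close> this]
  obtain x where x: "x \<in> K" and max: "\<And>y. y \<in> K \<Longrightarrow> q y y / b y y \<le> q x x / b x x" by blast
  have bx: "b x x > 0" using x K pos by blast
  define e where "e = (1 / sqrt (b x x)) *\<^sub>R x"
  have bf: "f (c *\<^sub>R y) (c *\<^sub>R y) = c\<^sup>2 * f y y" if "bilinear f" for f :: "'n form" and c y
    by (simp add: bilinear_lmul[OF that] bilinear_rmul[OF that] power2_eq_square)
  have "e \<in> W" using x W(1) by (simp add: e_def K_def subspace_mul)
  moreover have "b e e = 1" using bx by (simp add: e_def bf[OF bl] power_divide)
  moreover have "q w w \<le> q e e * b w w" if w: "w \<in> W" for w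
  proof (cases "w = 0")
    case True then show ?thesis by (simp add: bilinear_lzero[OF q] bilinear_lzero[OF bl])
  next
    case False
    have "(1 / norm w) *\<^sub>R w \<in> K"
      unfolding K_def using W(1) w False by (simp add: subspace_mul)
    from max[OF this] have "q w w / b w w \<le> q x x / b x x"
      using False by (simp add: bf[OF bl] bf[OF q])
    moreover have "q e e = q x x / b x x" using bx by (simp add: e_def bf[OF q] power_divide)
    ultimately show ?thesis using pos[OF False] by (simp add: pos_divide_le_eq)
  qed
  ultimately show thesis by (rule that)
qed

lemma quadratic_perturbation:
  fixes p r :: real
  assumes "\<And>t. 2 * t * p \<le> t\<^sup>2 * r"
  shows "p = 0"
proof (rule ccontr)
  assume "p \<noteq> 0"
  define s where "s = \<bar>r\<bar> + 1"
  have s: "s > 0" "r \<le> s" by (auto simp: s_def)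
  have "2 * (p / s) * p \<le> (p / s)\<^sup>2 * r" by (rule assms)
  also have "\<dots> \<le> (p / s)\<^sup>2 * s" using s by (intro mult_left_mono) auto
  also have "\<dots> = (p / s) * p" using s by (simp add: power2_eq_square)
  finally have "(p / s) * p \<le> 0" by simp
  then have "p * p \<le> 0" using s by (simp add: divide_le_0_iff mult_le_0_iff)
  then show False using \<open>p \<noteq> 0\<close> by (auto simp: mult_le_0_iff)
qed

text \<open>The first variation of the Rayleigh quotient vanishes at a maximum: moving from \<open>e\<close> in a
  direction \<open>w\<close> changes \<open>q\<close> to first order by \<open>2 * t * q e w\<close>, while the bound on \<open>q\<close> changes only
  to second order. So, inside \<open>W\<close>, the \<open>b\<close>-complement of \<open>e\<close> lies in its \<open>q\<close>-complement.\<close>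

lemma maximiser_orthogonal:
  fixes b q :: "('n::finite) form"
  assumes b: "inner_product b" and q: "bilinear q" "\<And>x y. q x y = q y x" and W: "subspace W"
    and e: "e \<in> W" "b e e = 1" "\<And>w. w \<in> W \<Longrightarrow> q w w \<le> q e e * b w w"
    and w: "w \<in> W" "b e w = 0"
  shows "q e w = 0"
proof (rule quadratic_perturbation)
  have bl: "bilinear b" and sym: "\<And>x y. b x y = b y x" using b by (auto simp: inner_product_def)
  fix t
  have "q (e + t *\<^sub>R w) (e + t *\<^sub>R w) \<le> q e e * b (e + t *\<^sub>R w) (e + t *\<^sub>R w)"
    using W e w by (intro e) (simp add: subspace_add subspace_mul)
  moreover have expand: "f (e + t *\<^sub>R w) (e + t *\<^sub>R w) = f e e + 2 * t * f e w + t\<^sup>2 * f w w"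
    if "bilinear f" "f w e = f e w" for f :: "'n form"
    using that(2) by (simp add: bilinear_ladd[OF that(1)] bilinear_radd[OF that(1)]
        bilinear_lmul[OF that(1)] bilinear_rmul[OF that(1)] power2_eq_square algebra_simps)
  ultimately show "2 * t * q e w \<le> t\<^sup>2 * (q e e * b w w - q w w)"
    unfolding expand[OF bl sym] expand[OF q] using e(2) w(2) by (simp add: algebra_simps)
qed

text \<open>The spectral theorem for a pair of forms: split off a maximiser of the Rayleigh quotient and
  continue in its orthogonal complement.\<close>

lemma simultaneous_diagonalisation_on:
  fixes b q :: "('n::finite) form"
  assumes b: "inner_product b" and q: "bilinear q" "\<And>x y. q x y = q y x"
  shows "subspace W \<Longrightarrow> dim W = m \<Longrightarrow>
    \<exists>e l. diagonalises b q e l m \<and> (\<forall>i<m. e i \<in> W)"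
proof (induction m arbitrary: W)
  case 0
  then show ?case by (simp add: diagonalises_def)
next
  case (Suc m)
  have bl: "bilinear b" and pos: "\<And>x. x \<noteq> 0 \<Longrightarrow> b x x > 0" and sym: "\<And>x y. b x y = b y x"
    using b by (auto simp: inner_product_def)
  obtain f where f: "f \<in> W" "b f f = 1" "\<And>w. w \<in> W \<Longrightarrow> q w w \<le> q f f * b w w"
    using rayleigh_maximiser[OF b q(1) Suc.prems(1)] Suc.prems(2) by auto
  define W' where "W' = {w \<in> W. b f w = 0}"
  have sub: "subspace W'"
    using Suc.prems(1) unfolding W'_def subspace_def
    by (simp add: bilinear_radd[OF bl] bilinear_rmul[OF bl] bilinear_rzero[OF bl])
  have "f \<notin> span W'"
    using f(2) by (simp add: span_eq_iff[THEN iffD2, OF sub]) (simp add: W'_def)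
  have "W = span (insert f W')"
  proof
    show "span (insert f W') \<subseteq> W"
      using f(1) Suc.prems(1) by (intro span_minimal) (auto simp: W'_def)
    show "W \<subseteq> span (insert f W')"
    proof
      fix w assume "w \<in> W"
      then have "w - b f w *\<^sub>R f \<in> W'"
        using f(1,2) Suc.prems(1)
        by (simp add: W'_def subspace_diff subspace_mul bilinear_rsub[OF bl] bilinear_rmul[OF bl])
      then show "w \<in> span (insert f W')"
        by (auto simp: span_breakdown_eq intro!: exI[of _ "b f w"] span_base)
    qed
  qed
  then have "dim W = Suc (dim W')"
    using \<open>f \<notin> span W'\<close> by (simp add: dim_span dim_insert)
  then have "dim W' = m" using Suc.prems(2) by simp
  then obtain e l where el: "diagonalises b q e l m" "\<forall>i<m. e i \<in> W'"
    using Suc.IH[OF sub] by blast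
  \<comment> \<open>The maximal value goes in front, which makes the eigenvalues come out decreasing.\<close>
  define e' where "e' = case_nat f e"
  define l' where "l' = case_nat (q f f) l"
  have orth: "b f (e i) = 0" "q f (e i) = 0" if "i < m" for i
    using el(2) that maximiser_orthogonal[OF b q Suc.prems(1) f] by (auto simp: W'_def)
  have orth': "b (e i) f = 0" "q (e i) f = 0" if "i < m" for i
    using orth[OF that] sym q(2) by metis+
  have le: "l i \<le> q f f" if "i < m" for i
    using f(3)[of "e i"] el that by (auto simp: diagonalises_def W'_def)
  have "diagonalises b q e' l' (Suc m)"
    unfolding diagonalises_def
  proof (intro conjI allI impI)
    fix i j assume "i < Suc m" "j < Suc m"
    then show "b (e' i) (e' j) = (if i = j then 1 else 0)"
      and "q (e' i) (e' j) = (if i = j then l' i else 0)"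
      using el(1) f(2) orth orth' unfolding diagonalises_def e'_def l'_def
      by (cases i; cases j; simp)+
  next
    fix i j assume "i \<le> j" "j < Suc m"
    then show "l' j \<le> l' i"
      using el(1) le unfolding diagonalises_def l'_def by (cases i; cases j; simp)
  qed
  moreover have "\<forall>i<Suc m. e' i \<in> W"
    using f(1) el(2) by (simp add: e'_def W'_def less_Suc_eq_0_disj) (auto)
  ultimately show ?case by blast
qed

lemma simultaneous_diagonalisation:
  fixes b q :: "('n::finite) form"
  assumes "inner_product b" "bilinear q" "\<And>x y. q x y = q y x"
  obtains e l where "diagonalises b q e l CARD('n)"
  using simultaneous_diagonalisation_on[OF assms, of UNIV "CARD('n)"] by (auto simp: dim_UNIV)

lemma diagonalises_system:
  fixes b q :: "('n::finite) form"
  assumes b: "inner_product b" and d: "diagonalises b q e l m" and I: "I \<subseteq> {..<m}"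
  shows "dim (span (e ` I)) = card I"
    and "w \<in> span (e ` I) \<Longrightarrow> \<exists>c. w = (\<Sum>i\<in>I. c i *\<^sub>R e i)"
proof -
  have fin: "finite I" using I finite_subset by blast
  have bl: "bilinear b" using b by (simp add: inner_product_def)
  have lt: "i < m" if "i \<in> I" for i using that I by auto
  have orth: "b (e i) (e j) = 0" if "i \<in> I" "j \<in> I" "i \<noteq> j" for i j
    using that lt d by (simp add: diagonalises_def)
  have nz: "e i \<noteq> 0" if "i \<in> I" for i
  proof
    assume "e i = 0"
    then have "b (e i) (e i) = 0" by (simp add: bilinear_lzero[OF bl])
    then show False using lt[OF that] d by (simp add: diagonalises_def)
  qed
  show "dim (span (e ` I)) = card I"
    by (rule orthogonal_system(3)[OF b fin orth nz])
  show "\<exists>c. w = (\<Sum>i\<in>I. c i *\<^sub>R e i)" if "w \<in> span (e ` I)"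
    by (rule orthogonal_system(4)[OF b fin orth nz that])
qed

lemma diagonalises_span_UNIV:
  fixes b q :: "('n::finite) form"
  assumes b: "inner_product b" and d: "diagonalises b q e l CARD('n)"
  shows "\<exists>c. w = (\<Sum>i\<in>{..<CARD('n)}. c i *\<^sub>R e i)"
proof -
  have "dim (span (e ` {..<CARD('n)})) = CARD('n)"
    using diagonalises_system(1)[OF b d order_refl] by simp
  then have "span (e ` {..<CARD('n)}) = UNIV"
    using dim_eq_full[of "span (e ` {..<CARD('n)})"] by (simp add: span_span)
  then show ?thesis using diagonalises_system(2)[OF b d order_refl] by blast
qed

lemma diagonalises_sum:
  fixes b q :: "('n::finite) form"
  assumes "bilinear b" "bilinear q" and d: "diagonalises b q e l m" and I: "I \<subseteq> {..<m}"
  shows "b (\<Sum>i\<in>I. c i *\<^sub>R e i) (\<Sum>i\<in>I. d i *\<^sub>R e i) = (\<Sum>i\<in>I. c i * d i)"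
    and "q (\<Sum>i\<in>I. c i *\<^sub>R e i) (\<Sum>i\<in>I. d i *\<^sub>R e i) = (\<Sum>i\<in>I. c i * d i * l i)"
proof -
  have fin: "finite I" using I finite_subset by blast
  have lt: "i < m" if "i \<in> I" for i using that I by auto
  have orth: "b (e i) (e j) = 0" "q (e i) (e j) = 0" if "i \<in> I" "j \<in> I" "i \<noteq> j" for i j
    using that lt d by (simp_all add: diagonalises_def)
  have diag: "b (e i) (e i) = 1" "q (e i) (e i) = l i" if "i \<in> I" for i
    using lt[OF that] d by (simp_all add: diagonalises_def)
  show "b (\<Sum>i\<in>I. c i *\<^sub>R e i) (\<Sum>i\<in>I. d i *\<^sub>R e i) = (\<Sum>i\<in>I. c i * d i)"
    using orthogonal_form_sum[OF assms(1) fin orth(1), where c = c and d = d] diag by simp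
  show "q (\<Sum>i\<in>I. c i *\<^sub>R e i) (\<Sum>i\<in>I. d i *\<^sub>R e i) = (\<Sum>i\<in>I. c i * d i * l i)"
    using orthogonal_form_sum[OF assms(2) fin orth(2), where c = c and d = d] diag by simp
qed


section \<open>Variational bounds for eigenvalues\<close>

lemma nontrivial_intersection:
  fixes U W :: "(real ^ 'n) set"
  assumes "subspace U" "subspace W" "dim U + dim W > CARD('n)"
  obtains w where "w \<in> U" "w \<in> W" "w \<noteq> 0"
proof -
  have "dim {x + y |x y. x \<in> U \<and> y \<in> W} \<le> CARD('n)"
    using dim_subset_UNIV[of "{x + y |x y. x \<in> U \<and> y \<in> W}"] by simp
  then have "dim (U \<inter> W) \<noteq> 0" using dim_sums_Int[OF assms(1,2)] assms(3) by linarith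
  then show thesis using that by (auto simp: dim_eq_0)
qed

text \<open>One half of the Courant--Fischer principle: \<open>W\<close> meets the span of the eigenvectors from
  index \<open>k\<close> on, where \<open>q\<close> is at most \<open>l k * b\<close>.\<close>

lemma eigenvalue_lower_bound:
  fixes b q :: "('n::finite) form"
  assumes b: "inner_product b" and q: "bilinear q" and d: "diagonalises b q e l CARD('n)"
    and k: "k < CARD('n)" and W: "subspace W" "k < dim W"
    and t: "\<And>w. w \<in> W \<Longrightarrow> t * b w w \<le> q w w"
  shows "t \<le> l k"
proof -
  have bl: "bilinear b" and pos: "\<And>x. x \<noteq> 0 \<Longrightarrow> b x x > 0"
    using b by (auto simp: inner_product_def)
  have I: "{k..<CARD('n)} \<subseteq> {..<CARD('n)}" by auto
  have "dim (span (e ` {k..<CARD('n)})) + dim W > CARD('n)"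
    unfolding diagonalises_system(1)[OF b d I] using W(2) k by simp
  then obtain w where w: "w \<in> span (e ` {k..<CARD('n)})" "w \<in> W" "w \<noteq> 0"
    using nontrivial_intersection[OF subspace_span W(1)] by blast
  then obtain c where c: "w = (\<Sum>i\<in>{k..<CARD('n)}. c i *\<^sub>R e i)"
    using diagonalises_system(2)[OF b d I] by blast
  have "t * b w w \<le> q w w" by (rule t[OF w(2)])
  also have "q w w = (\<Sum>i\<in>{k..<CARD('n)}. c i * c i * l i)"
    unfolding c by (rule diagonalises_sum(2)[OF bl q d I])
  also have "\<dots> \<le> (\<Sum>i\<in>{k..<CARD('n)}. c i * c i * l k)"
    using d by (intro sum_mono mult_left_mono) (auto simp: diagonalises_def)
  also have "\<dots> = l k * b w w"
    unfolding c diagonalises_sum(1)[OF bl q d I] by (simp add: sum_distrib_left mult.commute)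
  finally show ?thesis using pos[OF w(3)] by simp
qed

text \<open>The other half: \<open>W\<close> meets the span of the eigenvectors up to index \<open>k\<close>, where \<open>q\<close> is at least
  \<open>l k * b\<close>.\<close>

lemma eigenvalue_upper_bound:
  fixes b q :: "('n::finite) form"
  assumes b: "inner_product b" and q: "bilinear q" and d: "diagonalises b q e l CARD('n)"
    and k: "k < CARD('n)" and W: "subspace W" "dim W + k \<ge> CARD('n)"
    and t: "\<And>w. w \<in> W \<Longrightarrow> q w w \<le> t * b w w"
  shows "l k \<le> t"
proof -
  have bl: "bilinear b" and pos: "\<And>x. x \<noteq> 0 \<Longrightarrow> b x x > 0"
    using b by (auto simp: inner_product_def)
  have I: "{..k} \<subseteq> {..<CARD('n)}" using k by auto
  have "dim (span (e ` {..k})) + dim W > CARD('n)"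
    unfolding diagonalises_system(1)[OF b d I] using W(2) by simp
  then obtain w where w: "w \<in> span (e ` {..k})" "w \<in> W" "w \<noteq> 0"
    using nontrivial_intersection[OF subspace_span W(1)] by blast
  then obtain c where c: "w = (\<Sum>i\<in>{..k}. c i *\<^sub>R e i)"
    using diagonalises_system(2)[OF b d I] by blast
  have "l k * b w w = (\<Sum>i\<in>{..k}. c i * c i * l k)"
    unfolding c diagonalises_sum(1)[OF bl q d I] by (simp add: sum_distrib_left mult.commute)
  also have "\<dots> \<le> (\<Sum>i\<in>{..k}. c i * c i * l i)"
    using d k by (intro sum_mono mult_left_mono) (auto simp: diagonalises_def)
  also have "\<dots> = q w w"
    unfolding c by (rule diagonalises_sum(2)[OF bl q d I, symmetric])
  also have "\<dots> \<le> t * b w w" by (rule t[OF w(2)])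
  finally show ?thesis using pos[OF w(3)] by simp
qed

definition comparable :: "real \<Rightarrow> ('n::finite) form \<Rightarrow> 'n form \<Rightarrow> bool" where
  "comparable K b b' \<longleftrightarrow> (\<forall>w. b w w \<le> K * b' w w \<and> b' w w \<le> K * b w w)"

lemma decreasing_enumeration:
  fixes y :: "'n::finite \<Rightarrow> real"
  obtains f where "bij_betw f {..<CARD('n)} UNIV"
    "\<And>i j. i \<le> j \<Longrightarrow> j < CARD('n) \<Longrightarrow> y (f j) \<le> y (f i)"
proof -
  obtain xs where xs: "set xs = (UNIV :: 'n set)" "distinct xs"
    using finite_distinct_list[of "UNIV :: 'n set"] by auto
  define ys where "ys = sort_key (\<lambda>a. - y a) xs"
  have ys: "set ys = UNIV" "distinct ys" "length ys = CARD('n)"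
    using xs distinct_card[OF xs(2)] by (simp_all add: ys_def)
  have srt: "sorted (map (\<lambda>a. - y a) ys)" unfolding ys_def by simp
  show thesis
  proof (rule that[of "\<lambda>k. ys ! k"])
    show "bij_betw ((!) ys) {..<CARD('n)} UNIV"
      using bij_betw_nth[OF ys(2), of "{..<CARD('n)}" UNIV] ys by simp
    show "y (ys ! j) \<le> y (ys ! i)" if "i \<le> j" "j < CARD('n)" for i j
      using sorted_nth_mono[OF srt that(1)] that ys(3) by simp
  qed
qed

text \<open>If two forms are comparable to forms that share an orthogonal basis \<open>u\<close>, their relative
  eigenvalues are, up to a bounded factor, the ratios of the latter forms on the vectors of \<open>u\<close>,
  listed in decreasing order. Courant--Fischer applies to the spans of the first \<open>k + 1\<close> and of the
  last \<open>n - k\<close> of these vectors. The error is \<open>2 * ln K\<close> because both forms are replaced.\<close>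

lemma eigenvalues_near_orthogonal_basis:
  fixes b q b' q' :: "('n::finite) form" and u :: "'n \<Rightarrow> real ^ 'n"
  assumes b: "inner_product b" and q: "inner_product q"
    and d: "diagonalises b q e l CARD('n)"
    and b': "inner_product b'" and q': "inner_product q'"
    and u: "\<And>a. u a \<noteq> 0" "\<And>a c. a \<noteq> c \<Longrightarrow> b' (u a) (u c) = 0" "\<And>a c. a \<noteq> c \<Longrightarrow> q' (u a) (u c) = 0"
    and K: "K > 0" "comparable K b b'" "comparable K q q'"
  shows "\<exists>f. bij_betw f {..<CARD('n)} UNIV \<and>
    (\<forall>i j. i \<le> j \<longrightarrow> j < CARD('n) \<longrightarrow>
      ln (q' (u (f j)) (u (f j)) / b' (u (f j)) (u (f j))) \<le>
      ln (q' (u (f i)) (u (f i)) / b' (u (f i)) (u (f i)))) \<and>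
    (\<forall>k<CARD('n).
      \<bar>ln (l k) - ln (q' (u (f k)) (u (f k)) / b' (u (f k)) (u (f k)))\<bar> \<le> 2 * ln K)"
proof -
  let ?n = "CARD('n)"
  have bl: "bilinear b'" "bilinear q'" and qb: "bilinear q"
    using b' q' q by (auto simp: inner_product_def)
  define r where "r a = q' (u a) (u a) / b' (u a) (u a)" for a
  have bu: "b' (u a) (u a) > 0" and "q' (u a) (u a) > 0" for a
    using u(1)[of a] b' q' by (auto simp: inner_product_def)
  then have r: "r a > 0" for a by (simp add: r_def)
  have qr: "q' (u a) (u a) = r a * b' (u a) (u a)" for a using bu[of a] by (simp add: r_def)
  obtain f where f: "bij_betw f {..<?n} UNIV"
    and anti: "\<And>i j. i \<le> j \<Longrightarrow> j < ?n \<Longrightarrow> ln (r (f j)) \<le> ln (r (f i))"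
    using decreasing_enumeration[where y = "\<lambda>a. ln (r a)"] by blast
  have rmono: "r (f j) \<le> r (f i)" if "i \<le> j" "j < ?n" for i j
    using anti[OF that] r by simp
  have inj: "inj_on f I" if "I \<subseteq> {..<?n}" for I
    using f that by (metis bij_betw_def inj_on_subset)
  have dimW: "dim (span (u ` f ` I)) = card I" if "I \<subseteq> {..<?n}" for I
    using orthogonal_system(3)[OF b', where e = u and I = "f ` I"] u(1,2) card_image[OF inj[OF that]] by simp
  have form: "\<exists>c. b' w w = (\<Sum>a\<in>f ` I. (c a)\<^sup>2 * b' (u a) (u a)) \<and>
      q' w w = (\<Sum>a\<in>f ` I. (c a)\<^sup>2 * (r a * b' (u a) (u a)))"
    if "w \<in> span (u ` f ` I)" "I \<subseteq> {..<?n}" for w I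
  proof -
    have fin: "finite (f ` I)" by simp
    have "\<exists>c. w = (\<Sum>a\<in>f ` I. c a *\<^sub>R u a)"
      by (rule orthogonal_system(4)[OF b' fin]) (use u(1,2) that(1) in auto)
    then obtain c where c: "w = (\<Sum>a\<in>f ` I. c a *\<^sub>R u a)" ..
    have "b' w w = (\<Sum>a\<in>f ` I. c a * c a * b' (u a) (u a))"
      unfolding c by (rule orthogonal_form_sum[OF bl(1) fin u(2)])
    moreover have "q' w w = (\<Sum>a\<in>f ` I. c a * c a * q' (u a) (u a))"
      unfolding c by (rule orthogonal_form_sum[OF bl(2) fin u(3)])
    ultimately show ?thesis unfolding qr power2_eq_square by blast
  qed
  have cmp: "b w w \<le> K * b' w w" "b' w w \<le> K * b w w" "q w w \<le> K * q' w w" "q' w w \<le> K * q w w" for w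
    using K(2,3) by (auto simp: comparable_def)
  have lower: "r (f k) / K\<^sup>2 \<le> l k" if k: "k < ?n" for k
  proof (rule eigenvalue_lower_bound[OF b qb d k subspace_span])
    have I: "{..k} \<subseteq> {..<?n}" using k by auto
    show "k < dim (span (u ` f ` {..k}))" unfolding dimW[OF I] by simp
    fix w assume "w \<in> span (u ` f ` {..k})"
    then obtain c where c: "b' w w = (\<Sum>a\<in>f ` {..k}. (c a)\<^sup>2 * b' (u a) (u a))"
      "q' w w = (\<Sum>a\<in>f ` {..k}. (c a)\<^sup>2 * (r a * b' (u a) (u a)))"
      using form[OF _ I] by blast
    have "r (f k) * b' w w = (\<Sum>a\<in>f ` {..k}. (c a)\<^sup>2 * (r (f k) * b' (u a) (u a)))"
      unfolding c by (simp add: sum_distrib_left mult.left_commute)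
    also have "\<dots> \<le> q' w w"
      unfolding c(2) using rmono k bu
      by (intro sum_mono mult_left_mono mult_right_mono) (auto simp: less_imp_le)
    also have "\<dots> \<le> K * q w w" by (rule cmp)
    finally have "K * (r (f k) * b' w w) \<le> K * (K * q w w)"
      using K(1) by simp
    moreover have "r (f k) * b w w \<le> r (f k) * (K * b' w w)"
      using cmp(1)[of w] r[of "f k"] by (intro mult_left_mono) auto
    ultimately have "r (f k) * b w w \<le> K * (K * q w w)"
      by (simp only: mult.left_commute[of K "r (f k)"])
    then show "r (f k) / K\<^sup>2 * b w w \<le> q w w"
      using K(1) by (simp add: power2_eq_square divide_le_eq mult_ac)
  qed
  have upper: "l k \<le> K\<^sup>2 * r (f k)" if k: "k < ?n" for k
  proof (rule eigenvalue_upper_bound[OF b qb d k subspace_span])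
    have I: "{k..<?n} \<subseteq> {..<?n}" by auto
    show "?n \<le> dim (span (u ` f ` {k..<?n})) + k" unfolding dimW[OF I] by simp
    fix w assume "w \<in> span (u ` f ` {k..<?n})"
    then obtain c where c: "b' w w = (\<Sum>a\<in>f ` {k..<?n}. (c a)\<^sup>2 * b' (u a) (u a))"
      "q' w w = (\<Sum>a\<in>f ` {k..<?n}. (c a)\<^sup>2 * (r a * b' (u a) (u a)))"
      using form[OF _ I] by blast
    have "q' w w \<le> (\<Sum>a\<in>f ` {k..<?n}. (c a)\<^sup>2 * (r (f k) * b' (u a) (u a)))"
      unfolding c(2) using rmono k bu
      by (intro sum_mono mult_left_mono mult_right_mono) (auto simp: less_imp_le)
    also have "\<dots> = r (f k) * b' w w"
      unfolding c by (simp add: sum_distrib_left mult.left_commute)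
    also have "\<dots> \<le> r (f k) * (K * b w w)"
      using cmp(2)[of w] r[of "f k"] by (intro mult_left_mono) auto
    finally have "K * q' w w \<le> K * (r (f k) * (K * b w w))"
      using K(1) by (intro mult_left_mono) auto
    then show "q w w \<le> K\<^sup>2 * r (f k) * b w w"
      using cmp(3)[of w] by (simp add: power2_eq_square mult_ac)
  qed
  have "\<bar>ln (l k) - ln (r (f k))\<bar> \<le> 2 * ln K" if k: "k < ?n" for k
  proof -
    have pos: "r (f k) / K\<^sup>2 > 0" using r K(1) by simp
    then have "l k > 0" using lower[OF k] by linarith
    then have "ln (r (f k) / K\<^sup>2) \<le> ln (l k)" "ln (l k) \<le> ln (K\<^sup>2 * r (f k))"
      using pos lower[OF k] upper[OF k] by (simp_all add: r K(1))
    moreover have "ln (r (f k) / K\<^sup>2) = ln (r (f k)) - 2 * ln K" "ln (K\<^sup>2 * r (f k)) = 2 * ln K + ln (r (f k))"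
      using r[of "f k"] K(1) by (simp_all add: ln_div ln_mult ln_realpow)
    ultimately show ?thesis by linarith
  qed
  then show ?thesis using f anti unfolding r_def by (intro exI[of _ f] conjI allI impI)
qed


section \<open>Singular values and the Cartan projection\<close>

lemma decreasing_list_unique:
  fixes xs ys :: "real list"
  assumes "sorted_wrt (\<ge>) xs" "sorted_wrt (\<ge>) ys" "\<And>t. count_list xs t = count_list ys t"
  shows "xs = ys"
proof -
  have "mset (rev xs) = mset (rev ys)"
    using assms(3) by (simp add: multiset_eq_iff count_mset)
  moreover have "sorted (rev xs)" "sorted (rev ys)"
    using assms(1,2) by (simp_all add: sorted_wrt_rev)
  ultimately have "rev xs = rev ys" by (metis properties_for_sort)
  then show ?thesis by simp
qed

text \<open>The definition counts a singular value by the dimension of an eigenspace; in a diagonalising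
  basis that eigenspace is spanned by the basis vectors with the given eigenvalue.\<close>

lemma singular_values_eq:
  fixes b :: "('n::finite) form"
  assumes b: "inner_product b"
    and d: "diagonalises b (\<lambda>x y. b (M *v x) (M *v y)) e l CARD('n)"
  shows "singular_values b M = map (\<lambda>i. sqrt (l i)) [0..<CARD('n)]"
proof -
  let ?n = "CARD('n)" and ?q = "\<lambda>x y. b (M *v x) (M *v y)"
  let ?xs = "map (\<lambda>i. sqrt (l i)) [0..<?n]"
  have bl: "bilinear b" and pos: "\<And>x. x \<noteq> 0 \<Longrightarrow> b x x > 0"
    using b by (auto simp: inner_product_def)
  have ql: "bilinear ?q"
    using bl unfolding bilinear_def linear_iff
    by (simp add: matrix_vector_right_distrib matrix_vector_mult_scaleR)
  have l0: "l i \<ge> 0" if "i < ?n" for i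
  proof -
    have "l i = ?q (e i) (e i)" using d that by (simp add: diagonalises_def)
    then show ?thesis using pos bilinear_lzero[OF bl] by (metis less_eq_real_def)
  qed
  have sorted: "sorted_wrt (\<ge>) ?xs"
    using d by (auto simp: sorted_wrt_map sorted_wrt_iff_nth_less diagonalises_def)
  have "count_list ?xs t =
      (if t \<ge> 0 then dim {v. (adjoint_wrt b M ** M) *v v = t\<^sup>2 *\<^sub>R v} else 0)" for t
  proof -
    let ?I = "{i. i < ?n \<and> sqrt (l i) = t}"
    have "count_list ?xs t = card ?I"
      by (simp add: count_list_eq_length_filter filter_map o_def length_filter_conv_card)
        (auto intro!: arg_cong[where f = card])
    also have "\<dots> = (if t \<ge> 0 then dim {v. (adjoint_wrt b M ** M) *v v = t\<^sup>2 *\<^sub>R v} else 0)"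
    proof (cases "t \<ge> 0")
      case True
      have sub: "?I \<subseteq> {..<?n}" by auto
      have "{v. (adjoint_wrt b M ** M) *v v = t\<^sup>2 *\<^sub>R v} = span (e ` ?I)"
      proof (intro equalityI subsetI)
        fix v assume "v \<in> {v. (adjoint_wrt b M ** M) *v v = t\<^sup>2 *\<^sub>R v}"
        then have ev: "?q w v = t\<^sup>2 * b w v" for w by (simp add: eigen_iff[OF b])
        obtain c where c: "v = (\<Sum>i\<in>{..<?n}. c i *\<^sub>R e i)"
          using diagonalises_span_UNIV[OF b d] by blast
        have coeff: "c i *\<^sub>R e i \<in> span (e ` ?I)" if i: "i < ?n" for i
        proof -
          \<comment> \<open>Test the eigenvector equation against \<open>e i\<close>.\<close>
          define d' where "d' j = (if j = i then 1 else 0 :: real)" for j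
          have "(\<Sum>j<?n. d' j * c j * l j) = t\<^sup>2 * (\<Sum>j<?n. d' j * c j)"
            using ev[of "\<Sum>i\<in>{..<?n}. d' i *\<^sub>R e i"]
            unfolding c diagonalises_sum(1)[OF bl ql d order_refl]
              diagonalises_sum(2)[OF bl ql d order_refl] .
          then have "c i * l i = t\<^sup>2 * c i"
            using i by (simp add: d'_def if_distrib[where f = "\<lambda>x. x * _"] cong: if_cong)
          then have "c i = 0 \<or> sqrt (l i) = t"
            using True by (auto simp: real_sqrt_unique)
          then show ?thesis
          proof
            assume "c i = 0" then show ?thesis by (simp add: span_zero del: span_span)
          next
            assume "sqrt (l i) = t"
            then have "e i \<in> e ` ?I" using i by blast
            then show ?thesis by (intro span_mul span_base)
          qed
        qed
        show "v \<in> span (e ` ?I)" unfolding c by (rule span_sum) (use coeff in simp)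
      next
        fix v assume "v \<in> span (e ` ?I)"
        then obtain c where c: "v = (\<Sum>i\<in>?I. c i *\<^sub>R e i)"
          using diagonalises_system(2)[OF b d sub] by blast
        define c' where "c' i = (if i \<in> ?I then c i else 0)" for i
        have v: "v = (\<Sum>i\<in>{..<?n}. c' i *\<^sub>R e i)"
          unfolding c c'_def by (rule sum.mono_neutral_cong_left) auto
        have "?q w v = t\<^sup>2 * b w v" for w
        proof -
          obtain d' where d': "w = (\<Sum>i\<in>{..<?n}. d' i *\<^sub>R e i)"
            using diagonalises_span_UNIV[OF b d] by blast
          have "?q w v = (\<Sum>i<?n. d' i * c' i * l i)"
            unfolding v d' by (rule diagonalises_sum(2)[OF bl ql d order_refl])
          also have "\<dots> = (\<Sum>i<?n. t\<^sup>2 * (d' i * c' i))"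
            using l0 by (intro sum.cong) (auto simp: c'_def)
          also have "\<dots> = t\<^sup>2 * b w v"
            unfolding v d' diagonalises_sum(1)[OF bl ql d order_refl] by (simp add: sum_distrib_left)
          finally show ?thesis .
        qed
        then show "v \<in> {v. (adjoint_wrt b M ** M) *v v = t\<^sup>2 *\<^sub>R v}"
          by (simp add: eigen_iff[OF b])
      qed
      then show ?thesis using True diagonalises_system(1)[OF b d sub] by simp
    next
      case False
      then have "?I = {}" using l0 by (auto simp: real_sqrt_ge_zero)
      then show ?thesis using False by simp
    qed
    finally show ?thesis .
  qed
  with sorted show ?thesis
    unfolding singular_values_def
    by (intro the_equality conjI allI) (auto intro!: decreasing_list_unique)
qed

lemma scaling_class_refl: "b \<in> scaling_class b"
  by (auto simp: scaling_class_def intro!: exI[of _ 1])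

lemma scaling_class_eqI:
  assumes "c \<in> scaling_class b"
  shows "scaling_class c = scaling_class b"
proof -
  obtain s where s: "s > 0" "c = (\<lambda>x y. s * b x y)" using assms by (auto simp: scaling_class_def)
  have "(\<lambda>x y. t * b x y) \<in> scaling_class c" if "t > 0" for t
    using s that unfolding scaling_class_def by (auto intro!: exI[of _ "t / s"])
  moreover have "(\<lambda>x y. t * c x y) \<in> scaling_class b" if "t > 0" for t
    using s that unfolding scaling_class_def by (auto simp: mult.assoc intro!: exI[of _ "t * s"])
  ultimately show ?thesis by (auto simp: scaling_class_def)
qed

lemma sym_space_rep:
  assumes "p \<in> sym_space" "b \<in> p"
  shows "inner_product b" "p = scaling_class b"
proof -
  obtain c where c: "inner_product c" "p = scaling_class c" using assms by (auto simp: sym_space_def)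
  then show "p = scaling_class b" using scaling_class_eqI assms(2) by metis
  show "inner_product b" using assms(2) c by (auto simp: scaling_class_def inner_product_smult)
qed

lemma act_sym_space:
  assumes "p \<in> sym_space" "g \<in> carrier PGL"
  shows "act g p \<in> sym_space"
proof -
  obtain b where b: "inner_product b" "p = scaling_class b" using assms by (auto simp: sym_space_def)
  obtain M where M: "invertible M" "g = {c *\<^sub>R M | c. c \<noteq> 0}" using PGL_rep[OF assms(2)] by blast
  have "act g p = scaling_class (\<lambda>x y. b (matrix_inv M *v x) (matrix_inv M *v y))"
    unfolding b M using act_rep M(1) b(1) by (auto simp: inner_product_def)
  then show ?thesis
    using inner_product_act[OF b(1) invertible_matrix_inv[OF M(1)]] by (auto simp: sym_space_def)
qed

text \<open>The square root in a singular value becomes the factor \<open>1 / 2\<close> under the logarithm.\<close>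

lemma cartan_diagonalises:
  fixes b :: "('n::finite) form"
  assumes "inner_product b" "invertible M" "\<bar>det M\<bar> = 1"
    and "diagonalises b (\<lambda>x y. b (M *v x) (M *v y)) e l CARD('n)"
  shows "length (cartan (scaling_class b) {c *\<^sub>R M | c. c \<noteq> 0}) = CARD('n)"
    and "i < CARD('n) \<Longrightarrow> cartan (scaling_class b) {c *\<^sub>R M | c. c \<noteq> 0} ! i = ln (l i) / 2"
    and "i < CARD('n) \<Longrightarrow> l i > 0"
proof -
  show pos: "l i > 0" if "i < CARD('n)" for i
  proof -
    have ip: "inner_product (\<lambda>x y. b (M *v x) (M *v y))" by (rule inner_product_act[OF assms(1,2)])
    have *: "b (e i) (e i) = 1" "b (M *v e i) (M *v e i) = l i"
      using assms(4) that by (simp_all add: diagonalises_def)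
    then have "e i \<noteq> 0" using assms(1) by (auto simp: inner_product_def bilinear_lzero)
    then show ?thesis using ip * by (auto simp: inner_product_def)
  qed
  show "length (cartan (scaling_class b) {c *\<^sub>R M | c. c \<noteq> 0}) = CARD('n)"
    unfolding cartan_eq[OF assms(1-3)] singular_values_eq[OF assms(1,4)] by simp
  show "cartan (scaling_class b) {c *\<^sub>R M | c. c \<noteq> 0} ! i = ln (l i) / 2" if "i < CARD('n)"
    unfolding cartan_eq[OF assms(1-3)] singular_values_eq[OF assms(1,4)]
    using that pos[OF that] by (simp add: ln_sqrt)
qed

text \<open>Inner products in the classes \<open>g p\<close> and \<open>g h p\<close> have relative eigenvalues that determine the
  gaps of \<open>\<mu>(h)\<close>. Stating this for gaps, not for single coordinates, makes it independent of
  the choice of representatives in the two scaling classes.\<close>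

lemma cartan_gap:
  fixes p :: "('n::finite) form set"
  assumes p: "p \<in> sym_space" and g: "g \<in> carrier PGL" and h: "h \<in> carrier PGL"
    and b1: "b1 \<in> act g p" and b2: "b2 \<in> act (g \<otimes>\<^bsub>PGL\<^esub> h) p"
    and d: "diagonalises b2 b1 e l CARD('n)" and ij: "i < CARD('n)" "j < CARD('n)"
  shows "cartan p h ! i - cartan p h ! j = (ln (l i) - ln (l j)) / 2"
proof -
  obtain b where b: "inner_product b" "p = scaling_class b" using p by (auto simp: sym_space_def)
  have bl: "bilinear b" using b by (simp add: inner_product_def)
  obtain M where M: "invertible M" "\<bar>det M\<bar> = 1" "g = {c *\<^sub>R M | c. c \<noteq> 0}"
    using PGL_rep[OF g] by blast
  obtain N where N: "invertible N" "\<bar>det N\<bar> = 1" "h = {c *\<^sub>R N | c. c \<noteq> 0}"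
    using PGL_rep[OF h] by blast
  define P where "P = M ** N"
  have P: "invertible P" unfolding P_def by (intro invertible_mult M N)
  obtain s where s: "s > 0" "b1 = (\<lambda>x y. s * b (matrix_inv M *v x) (matrix_inv M *v y))"
    using b1 unfolding b(2) M(3) act_rep[OF M(1) bl] by (auto simp: scaling_class_def)
  obtain t where t: "t > 0" "b2 = (\<lambda>x y. t * b (matrix_inv P *v x) (matrix_inv P *v y))"
    using b2 unfolding b(2) M(3) N(3) mult_PGL P_def[symmetric] act_rep[OF P bl]
    by (auto simp: scaling_class_def)
  have MP: "matrix_inv M *v x = N *v (matrix_inv P *v x)" for x
  proof -
    have "x = M *v (N *v (matrix_inv P *v x))"
      using matrix_inv_works'(1)[OF P] by (simp add: P_def matrix_vector_mul_assoc matrix_mul_assoc)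
    then show ?thesis using matrix_inv_works'(2)[OF M(1)] by metis
  qed
  \<comment> \<open>Transport the diagonalising basis back by \<open>P\<close>; the scalars \<open>s\<close> and \<open>t\<close> of the
    representatives multiply all eigenvalues by the same factor.\<close>
  define e' where "e' i = sqrt t *\<^sub>R (matrix_inv P *v e i)" for i
  define l' where "l' i = t / s * l i" for i
  have bf: "b (sqrt t *\<^sub>R x) (sqrt t *\<^sub>R y) = t * b x y" for x y
    using t(1) by (simp add: bilinear_lmul[OF bl] bilinear_rmul[OF bl])
  have "diagonalises b (\<lambda>x y. b (N *v x) (N *v y)) e' l' CARD('n)"
    unfolding diagonalises_def
  proof (intro conjI allI impI)
    fix i j assume ij: "i < CARD('n)" "j < CARD('n)"
    have "b (e' i) (e' j) = b2 (e i) (e j)" unfolding e'_def bf t(2) ..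
    then show "b (e' i) (e' j) = (if i = j then 1 else 0)" using d ij by (simp add: diagonalises_def)
    have "b (N *v e' i) (N *v e' j) = t / s * b1 (e i) (e j)"
      unfolding e'_def matrix_vector_mult_scaleR bf s(2) MP using s(1) by simp
    then show "b (N *v e' i) (N *v e' j) = (if i = j then l' i else 0)"
      using d ij by (simp add: diagonalises_def l'_def)
  next
    fix i j assume "i \<le> j" "j < CARD('n)"
    then show "l' j \<le> l' i"
      using d s(1) t(1) unfolding l'_def diagonalises_def by (intro mult_left_mono) auto
  qed
  from cartan_diagonalises(2,3)[OF b(1) N(1,2) this]
  have c: "cartan p h ! i = ln (l' i) / 2" and "l' i > 0" if "i < CARD('n)" for i
    using that unfolding b(2) N(3) by auto
  then have "l i > 0" if "i < CARD('n)" for i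
    using that s(1) t(1) by (force simp: l'_def zero_less_mult_iff zero_less_divide_iff)
  then have "ln (l' i) = ln (t / s) + ln (l i)" if "i < CARD('n)" for i
    using ln_mult_pos[of "t / s" "l i"] that s(1) t(1) by (simp add: l'_def)
  then show ?thesis using c ij by simp
qed


section \<open>Distance in the symmetric space\<close>

text \<open>Needed to evaluate \<^const>\<open>dist_X\<close>, whose definition chooses a group element that moves one point
  to the other.\<close>

lemma act_transitive:
  fixes p q :: "('n::finite) form set"
  assumes "p \<in> sym_space" "q \<in> sym_space"
  shows "\<exists>g\<in>carrier PGL. act g p = q"
proof -
  obtain b where b: "inner_product b" "p = scaling_class b" using assms by (auto simp: sym_space_def)
  obtain b' where b': "inner_product b'" "q = scaling_class b'" using assms by (auto simp: sym_space_def)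
  have bl: "bilinear b" "bilinear b'" using b b' by (auto simp: inner_product_def)
  have sym': "\<And>x y. b' x y = b' y x" using b' by (auto simp: inner_product_def)
  let ?n = "CARD('n)"
  obtain e l where d: "diagonalises b b' e l ?n"
    using simultaneous_diagonalisation[OF b(1) bl(2) sym'] by blast
  have l: "l i \<ge> 0" if "i < ?n" for i
  proof -
    have "l i = b' (e i) (e i)" using d that by (simp add: diagonalises_def)
    then show ?thesis using b'(1) bilinear_lzero[OF bl(2)] unfolding inner_product_def
      by (metis less_eq_real_def)
  qed
  \<comment> \<open>The \<open>b\<close>-positive square root of the operator that turns \<open>b\<close> into \<open>b'\<close>.\<close>
  define F where "F x = (\<Sum>i\<in>{..<?n}. (b (e i) x * sqrt (l i)) *\<^sub>R e i)" for x
  have "linear F" unfolding F_def linear_iff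
    by (simp add: bilinear_radd[OF bl(1)] bilinear_rmul[OF bl(1)] sum.distrib scaleR_sum_right
        algebra_simps)
  then have N: "matrix F *v x = F x" for x by (simp add: matrix_works)
  have coeff: "b (e j) (\<Sum>i\<in>{..<?n}. c i *\<^sub>R e i) = c j" if j: "j < ?n" for c j
  proof -
    have "b (\<Sum>i\<in>{..<?n}. (if i = j then 1 else 0) *\<^sub>R e i) (\<Sum>i\<in>{..<?n}. c i *\<^sub>R e i) =
        (\<Sum>i\<in>{..<?n}. (if i = j then 1 else 0) * c i)"
      by (rule diagonalises_sum(1)[OF bl d order_refl])
    then show ?thesis
      using j by (simp add: if_distrib[where f = "\<lambda>x. x * _"] if_distrib[where f = "\<lambda>x. x *\<^sub>R _"] cong: if_cong)
  qed
  have iso: "b (matrix F *v x) (matrix F *v y) = b' x y" for x y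
  proof -
    obtain c where c: "x = (\<Sum>i\<in>{..<?n}. c i *\<^sub>R e i)"
      using diagonalises_span_UNIV[OF b(1) d] by blast
    obtain c' where c': "y = (\<Sum>i\<in>{..<?n}. c' i *\<^sub>R e i)"
      using diagonalises_span_UNIV[OF b(1) d] by blast
    have "b (F x) (F y) = (\<Sum>i\<in>{..<?n}. (b (e i) x * sqrt (l i)) * (b (e i) y * sqrt (l i)))"
      unfolding F_def by (rule diagonalises_sum(1)[OF bl d order_refl])
    also have "\<dots> = (\<Sum>i\<in>{..<?n}. c i * c' i * l i)"
    proof (rule sum.cong)
      fix i assume "i \<in> {..<?n}"
      then have "b (e i) x = c i" "b (e i) y = c' i" "sqrt (l i) * sqrt (l i) = l i"
        using coeff l by (simp_all add: c c')
      then show "(b (e i) x * sqrt (l i)) * (b (e i) y * sqrt (l i)) = c i * c' i * l i"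
        by (simp add: mult_ac)
    qed simp
    also have "\<dots> = b' x y"
      unfolding c c' by (rule diagonalises_sum(2)[OF bl d order_refl, symmetric])
    finally show ?thesis by (simp add: N)
  qed
  have "x = 0" if "matrix F *v x = 0" for x
  proof (rule ccontr)
    assume "x \<noteq> 0"
    then have "b' x x > 0" using b'(1) by (simp add: inner_product_def)
    then show False using iso[of x x] that bilinear_lzero[OF bl(1)] by simp
  qed
  then have inv: "invertible (matrix F)"
    by (simp add: invertible_left_inverse matrix_left_invertible_ker)
  define L where "L = matrix_inv (matrix F)"
  have L: "invertible L" "matrix_inv L = matrix F"
    unfolding L_def using inv by (auto intro: invertible_matrix_inv matrix_inv_eqI matrix_inv_works)
  have "act {c *\<^sub>R L | c. c \<noteq> 0} p = q"
    unfolding b(2) act_rep[OF L(1) bl(1)] L(2) iso b'(2) ..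
  moreover have "{c *\<^sub>R L | c. c \<noteq> 0} \<in> carrier PGL" using L(1) by (auto simp: carrier_PGL)
  ultimately show ?thesis by blast
qed

lemma list_norm_nth:
  assumes "k < length x"
  shows "\<bar>x ! k\<bar> \<le> list_norm x"
proof -
  have "(x ! k)\<^sup>2 \<le> (\<Sum>i\<in>{0..<length x}. (x ! i)\<^sup>2)"
    using assms by (intro member_le_sum[of k _ "\<lambda>i. (x ! i)\<^sup>2"]) auto
  also have "\<dots> = (\<Sum>t\<leftarrow>x. t\<^sup>2)" by (simp add: sum_list_sum_nth)
  finally show ?thesis using real_sqrt_le_mono unfolding list_norm_def by fastforce
qed

text \<open>The distance bounds every singular value of the element that moves \<open>p\<close> to \<open>q\<close> between
  \<open>exp (- C)\<close> and \<open>exp C\<close>; squares of singular values compare the quadratic forms.\<close>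

lemma dist_X_comparable:
  fixes p q :: "('n::finite) form set"
  assumes p: "p \<in> sym_space" and q: "q \<in> sym_space" and C: "dist_X p q \<le> C" and b: "b \<in> p"
  shows "\<exists>b'\<in>q. comparable (exp (2 * C)) b b'"
proof -
  have ip: "inner_product b" and pb: "p = scaling_class b" using sym_space_rep[OF p b] .
  have bl: "bilinear b" and sym: "\<And>x y. b x y = b y x" using ip by (auto simp: inner_product_def)
  \<comment> \<open>The element that the definition of the distance picks.\<close>
  define g where "g = (SOME g. g \<in> carrier PGL \<and> act g p = q)"
  have g: "g \<in> carrier PGL" "act g p = q"
    using someI_ex[of "\<lambda>g. g \<in> carrier PGL \<and> act g p = q"] act_transitive[OF p q]
    unfolding g_def by blast+
  obtain L where L: "invertible L" "\<bar>det L\<bar> = 1" "g = {c *\<^sub>R L | c. c \<noteq> 0}"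
    using PGL_rep[OF g(1)] by blast
  have ip2: "inner_product (\<lambda>x y. b (L *v x) (L *v y))" by (rule inner_product_act[OF ip L(1)])
  then have bl2: "bilinear (\<lambda>x y. b (L *v x) (L *v y))" by (simp add: inner_product_def)
  obtain e l where d: "diagonalises b (\<lambda>x y. b (L *v x) (L *v y)) e l CARD('n)"
    using simultaneous_diagonalisation[OF ip bl2] sym by blast
  note cd = cartan_diagonalises[OF ip L(1,2) d]
  have "\<bar>ln (l i) / 2\<bar> \<le> C" if "i < CARD('n)" for i
  proof -
    have "\<bar>cartan p g ! i\<bar> \<le> list_norm (cartan p g)"
      by (rule list_norm_nth) (simp add: pb L(3) cd(1) that)
    also have "\<dots> \<le> C" using C unfolding dist_X_def g_def .
    finally show ?thesis by (simp add: pb L(3) cd(2) that)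
  qed
  then have ln: "\<bar>ln (l i)\<bar> \<le> 2 * C" if "i < CARD('n)" for i using that by fastforce
  have le: "l i \<le> exp (2 * C)" "1 \<le> exp (2 * C) * l i" if i: "i < CARD('n)" for i
  proof -
    have li: "l i = exp (ln (l i))" using cd(3)[OF i] by simp
    have "exp (ln (l i)) \<le> exp (2 * C)" using ln[OF i] by simp
    then show "l i \<le> exp (2 * C)" unfolding li[symmetric] .
    have "1 \<le> exp (2 * C + ln (l i))" using ln[OF i] by simp
    then show "1 \<le> exp (2 * C) * l i" unfolding exp_add li[symmetric] .
  qed
  have two: "b (L *v w) (L *v w) \<le> exp (2 * C) * b w w" "b w w \<le> exp (2 * C) * b (L *v w) (L *v w)" for w
  proof -
    obtain c where c: "w = (\<Sum>i\<in>{..<CARD('n)}. c i *\<^sub>R e i)"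
      using diagonalises_span_UNIV[OF ip d] by blast
    have 1: "b w w = (\<Sum>i\<in>{..<CARD('n)}. c i * c i)"
      unfolding c by (rule diagonalises_sum(1)[OF bl bl2 d order_refl])
    have 2: "b (L *v w) (L *v w) = (\<Sum>i\<in>{..<CARD('n)}. c i * c i * l i)"
      unfolding c by (rule diagonalises_sum(2)[OF bl bl2 d order_refl])
    show "b (L *v w) (L *v w) \<le> exp (2 * C) * b w w"
      unfolding 1 2 sum_distrib_left mult.commute[of "exp _"]
      using le(1) by (intro sum_mono mult_left_mono) auto
    have "c i * c i \<le> exp (2 * C) * (c i * c i * l i)" if "i < CARD('n)" for i
      using mult_left_mono[OF le(2)[OF that], of "c i * c i"] by (simp add: mult_ac)
    then show "b w w \<le> exp (2 * C) * b (L *v w) (L *v w)"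
      unfolding 1 2 sum_distrib_left by (intro sum_mono) auto
  qed
  define b' where "b' = (\<lambda>x y. b (matrix_inv L *v x) (matrix_inv L *v y))"
  have "b' \<in> q"
    unfolding g(2)[symmetric] pb L(3) act_rep[OF L(1) bl] b'_def by (rule scaling_class_refl)
  moreover have "comparable (exp (2 * C)) b b'"
    unfolding comparable_def b'_def using two[of "matrix_inv L *v _"] matrix_inv_works'(1)[OF L(1)] by metis
  ultimately show ?thesis by blast
qed


section \<open>Coordinates along a maximal flat\<close>

text \<open>A nonzero vector on each line of the decomposition gives a basis that is orthogonal for all inner
  products in the flat. That flats are nonempty is what gives the infimum in
  \<^const>\<open>dist_X_set\<close> a meaning.\<close>

lemma maximal_flat_basis:
  fixes F :: "('n::finite) form set set"
  assumes "maximal_flat F"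
  shows "F \<noteq> {}" and "F \<subseteq> sym_space"
    and "\<exists>u :: 'n \<Rightarrow> real ^ 'n. (\<forall>a. u a \<noteq> 0) \<and>
      (\<forall>p\<in>F. \<forall>b\<in>p. \<forall>a c. a \<noteq> c \<longrightarrow> b (u a) (u c) = 0)"
proof -
  let ?n = "CARD('n)"
  obtain Ls where Ls: "line_decomposition Ls" and
    F: "F = {p \<in> sym_space. \<forall>b\<in>p. orthogonal_decomposition b Ls}"
    using assms by (auto simp: maximal_flat_def)
  have line: "subspace L" "dim L = 1" if "L \<in> Ls" for L
    using Ls that by (auto simp: line_decomposition_def)
  have card: "card Ls = ?n" and full: "span (\<Union>Ls) = UNIV"
    using Ls by (auto simp: line_decomposition_def)
  have "finite Ls" using card by (intro card_ge_0_finite) simp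
  then obtain h where h: "bij_betw h (UNIV :: 'n set) Ls"
    using finite_same_card_bij[of "UNIV :: 'n set" Ls] card by auto
  have hL: "h a \<in> Ls" for a using h by (auto simp: bij_betw_def)
  have "\<exists>v. v \<noteq> 0 \<and> h a = span {v}" for a
  proof -
    obtain B where B: "B \<subseteq> h a" "independent B" "h a \<subseteq> span B" "card B = dim (h a)"
      using basis_exists[of "h a"] by blast
    then obtain v where v: "B = {v}" using line(2)[OF hL] by (metis card_1_singletonE)
    then have "v \<noteq> 0" using B(2) dependent_zero by blast
    moreover have "h a = span {v}"
      using B(1,3) span_minimal[OF _ line(1)[OF hL]] v by (metis subset_antisym)
    ultimately show ?thesis by blast
  qed
  then obtain u where u: "\<And>a. u a \<noteq> 0" "\<And>a. h a = span {u a}" by metis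
  have uh: "u a \<in> h a" for a unfolding u(2) by (rule span_base) simp
  have spanu: "span (range u) = UNIV"
  proof -
    have "L \<subseteq> span (range u)" if "L \<in> Ls" for L
    proof -
      have "L \<in> range h" using that h by (simp add: bij_betw_def)
      then obtain a where "L = h a" by blast
      then show ?thesis unfolding u(2) by (simp add: span_mono)
    qed
    then have "span (\<Union>Ls) \<subseteq> span (range u)" by (intro span_minimal) auto
    then show ?thesis using full by auto
  qed
  have card_u: "card (range u) \<le> ?n" by (rule card_image_le) simp
  have ind: "independent (range u)"
    by (rule card_le_dim_spanning[of _ UNIV]) (use spanu card_u in auto)
  have "card (range u) = ?n"
    using dim_span_eq_card_independent[OF ind] spanu by simp
  then have inju: "inj u" by (simp add: eq_card_imp_inj_on)
  \<comment> \<open>A point of the flat: the inner product that makes \<open>u\<close> an orthonormal basis.\<close>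
  obtain G where G: "linear G" "\<And>x. x \<in> range u \<Longrightarrow> G x = axis (inv_into UNIV u x) (1::real)"
    using linear_independent_extend[OF ind, of "\<lambda>x. axis (inv_into UNIV u x) 1"] by blast
  have Gu: "G (u a) = axis a 1" for a using G(2)[of "u a"] inju by simp
  have "surj G"
  proof -
    have "x \<in> range G" for x
    proof -
      have "G (\<Sum>a\<in>UNIV. x $ a *\<^sub>R u a) = (\<Sum>a\<in>UNIV. x $ a *\<^sub>R axis a 1)"
        by (simp add: linear_sum[OF G(1)] linear_scale[OF G(1)] Gu)
      also have "\<dots> = x" using basis_expansion[of x] by (simp add: scalar_mult_eq_scaleR)
      finally show ?thesis by (metis rangeI)
    qed
    then show ?thesis by blast
  qed
  then have "inj G" using G(1) by (simp add: linear_surj_imp_inj)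
  define b where "b x y = G x \<bullet> G y" for x y
  have "G x \<noteq> 0" if "x \<noteq> 0" for x
    using \<open>inj G\<close> that linear_0[OF G(1)] by (metis injD)
  then have ip: "inner_product b"
    unfolding inner_product_def bilinear_def linear_iff b_def
    by (simp add: linear_add[OF G(1)] linear_scale[OF G(1)] inner_add_left inner_add_right inner_commute)
  have orth: "b x y = 0" if "L \<in> Ls" "L' \<in> Ls" "L \<noteq> L'" "x \<in> L" "y \<in> L'" for L L' x y
  proof -
    have "L \<in> range h" "L' \<in> range h" using that h by (simp_all add: bij_betw_def)
    with that obtain a c where ac: "L = h a" "L' = h c" "x \<in> h a" "y \<in> h c" by blast
    then obtain s t where "x = s *\<^sub>R u a" "y = t *\<^sub>R u c"
      using u(2) by (auto simp: span_singleton)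
    then show ?thesis using ac(1,2) that(3)
      by (auto simp: b_def linear_scale[OF G(1)] Gu inner_axis_axis)
  qed
  have "scaling_class b \<in> F"
    unfolding F
  proof (intro CollectI conjI ballI)
    show "scaling_class b \<in> sym_space" using ip by (auto simp: sym_space_def)
    fix f assume "f \<in> scaling_class b"
    then obtain s where s: "f = (\<lambda>x y. s * b x y)" by (auto simp: scaling_class_def)
    show "orthogonal_decomposition f Ls"
      unfolding orthogonal_decomposition_def s
      by (intro ballI impI) (simp add: orth)
  qed
  then show "F \<noteq> {}" by blast
  show "F \<subseteq> sym_space" unfolding F by blast
  have "b (u a) (u c) = 0" if "p \<in> F" "b \<in> p" "a \<noteq> c" for p b a c
  proof -
    have "h a \<noteq> h c" using h that(3) by (auto simp: bij_betw_def inj_def)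
    then show ?thesis using that hL uh unfolding F orthogonal_decomposition_def by blast
  qed
  then show "\<exists>u :: 'n \<Rightarrow> real ^ 'n. (\<forall>a. u a \<noteq> 0) \<and>
      (\<forall>p\<in>F. \<forall>b\<in>p. \<forall>a c. a \<noteq> c \<longrightarrow> b (u a) (u c) = 0)"
    using u(1) by (intro exI[of _ u]) simp
qed

text \<open>Up to an additive constant and an error \<open>E\<close>, the list \<open>x\<close> is the decreasing rearrangement of the
  family \<open>y\<close>; the bijection \<open>f\<close> performs the rearrangement.\<close>

definition gaps_match :: "real \<Rightarrow> real list \<Rightarrow> ('n::finite \<Rightarrow> real) \<Rightarrow> bool" where
  "gaps_match E x y \<longleftrightarrow> (\<exists>f. bij_betw f {..<CARD('n)} UNIV \<and>
     (\<forall>k m. k \<le> m \<longrightarrow> m < CARD('n) \<longrightarrow> y (f m) \<le> y (f k)) \<and>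
     (\<forall>k<CARD('n). \<forall>m<CARD('n). \<bar>(x ! k - x ! m) - (y (f k) - y (f m))\<bar> \<le> E))"

text \<open>Near a flat, Cartan projections can be read off from coordinates: \<open>X i a\<close> is minus half the
  logarithm of the squared length of the vector \<open>u a\<close> on the line \<open>a\<close>, measured by an inner product
  in the flat close to \<open>g i p\<close>. Rescaling that inner product adds a constant to all \<open>X i a\<close>, which
  gaps do not see.\<close>

lemma flat_coordinates:
  fixes p :: "('n::finite) form set" and g :: "nat \<Rightarrow> (real ^ 'n ^ 'n) set"
  assumes p: "p \<in> sym_space" and F: "maximal_flat F"
    and g: "\<And>i. g i \<in> carrier PGL" and near: "\<And>i. dist_X_set (act (g i) p) F \<le> C"
  shows "\<exists>X :: nat \<Rightarrow> 'n \<Rightarrow> real. \<forall>i j. \<forall>h\<in>carrier PGL. g j = g i \<otimes>\<^bsub>PGL\<^esub> h \<longrightarrow>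
    gaps_match (4 * (C + 1)) (cartan p h) (\<lambda>a. X j a - X i a)"
proof -
  let ?n = "CARD('n)" and ?K = "exp (2 * (C + 1))"
  from maximal_flat_basis(3)[OF F] obtain u :: "'n \<Rightarrow> real ^ 'n" where
    u': "\<forall>a. u a \<noteq> 0" "\<forall>p\<in>F. \<forall>b\<in>p. \<forall>a c. a \<noteq> c \<longrightarrow> b (u a) (u c) = 0"
    by (elim exE conjE)
  have u: "u a \<noteq> 0" "q \<in> F \<Longrightarrow> b \<in> q \<Longrightarrow> a \<noteq> c \<Longrightarrow> b (u a) (u c) = 0" for a c b q
    using u' by simp_all
  \<comment> \<open>The infimum that defines the distance to the flat need not be attained: hence \<open>C + 1\<close>.\<close>
  have "\<exists>b b' q. b \<in> act (g i) p \<and> inner_product b \<and> q \<in> F \<and> b' \<in> q \<and> inner_product b' \<and> comparable ?K b b'" for i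
  proof -
    have gp: "act (g i) p \<in> sym_space" by (rule act_sym_space[OF p g])
    then obtain b where b: "b \<in> act (g i) p" unfolding sym_space_def using scaling_class_refl by blast
    have "(INF q\<in>F. dist_X (act (g i) p) q) < C + 1" using near[of i] unfolding dist_X_set_def by simp
    from cInf_lessD[OF _ this]
    obtain q where q: "q \<in> F" "dist_X (act (g i) p) q < C + 1"
      using maximal_flat_basis(1)[OF F] by blast
    then have qs: "q \<in> sym_space" using maximal_flat_basis(2)[OF F] by blast
    obtain b' where "b' \<in> q" "comparable ?K b b'" using dist_X_comparable[OF gp qs less_imp_le[OF q(2)] b] by blast
    then show ?thesis using b q(1) sym_space_rep(1)[OF gp b] sym_space_rep(1)[OF qs] by blast
  qed
  then obtain b b' q where b: "\<And>i. b i \<in> act (g i) p" "\<And>i. inner_product (b i)"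
    and b': "\<And>i. q i \<in> F" "\<And>i. b' i \<in> q i" "\<And>i. inner_product (b' i)" "\<And>i. comparable ?K (b i) (b' i)"
    by metis
  have orth: "b' i (u a) (u c) = 0" if "a \<noteq> c" for i a c using u(2) b' that by blast
  have pos: "b' i (u a) (u a) > 0" for i a using b'(3) u(1) by (simp add: inner_product_def)
  \<comment> \<open>The sign makes \<open>X\<close> grow along a line whose vectors become short.\<close>
  define X where "X i a = - ln (b' i (u a) (u a)) / 2" for i a
  have lnX: "ln (b' i (u a) (u a) / b' j (u a) (u a)) = 2 * (X j a - X i a)" for i j a
    using pos[of i a] pos[of j a] by (simp add: X_def ln_div)
  show ?thesis
  proof (intro exI[of _ X] allI ballI impI)
    fix i j h assume h: "h \<in> carrier PGL" and gh: "g j = g i \<otimes>\<^bsub>PGL\<^esub> h"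
    have bi: "bilinear (b i)" "\<And>x y. b i x y = b i y x" using b(2) by (auto simp: inner_product_def)
    obtain e l where d: "diagonalises (b j) (b i) e l ?n"
      using simultaneous_diagonalisation[OF b(2) bi] by blast
    have "\<exists>f. bij_betw f {..<?n} UNIV \<and>
        (\<forall>k m. k \<le> m \<longrightarrow> m < ?n \<longrightarrow>
          ln (b' i (u (f m)) (u (f m)) / b' j (u (f m)) (u (f m))) \<le>
          ln (b' i (u (f k)) (u (f k)) / b' j (u (f k)) (u (f k)))) \<and>
        (\<forall>k<?n. \<bar>ln (l k) - ln (b' i (u (f k)) (u (f k)) / b' j (u (f k)) (u (f k)))\<bar> \<le> 2 * ln ?K)"
      by (rule eigenvalues_near_orthogonal_basis[OF b(2) b(2) d b'(3) b'(3)])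
        (rule u(1) orth b'(4) exp_gt_zero | assumption)+
    then obtain f where f: "bij_betw f {..<?n} UNIV"
      "\<And>k m. k \<le> m \<Longrightarrow> m < ?n \<Longrightarrow> 2 * (X j (f m) - X i (f m)) \<le> 2 * (X j (f k) - X i (f k))"
      "\<And>k. k < ?n \<Longrightarrow> \<bar>ln (l k) - 2 * (X j (f k) - X i (f k))\<bar> \<le> 4 * (C + 1)"
      unfolding lnX ln_exp by auto
    have "\<bar>(cartan p h ! k - cartan p h ! m) -
        ((X j (f k) - X i (f k)) - (X j (f m) - X i (f m)))\<bar> \<le> 4 * (C + 1)"
      if "k < ?n" "m < ?n" for k m
      using f(3)[OF that(1)] f(3)[OF that(2)]
        cartan_gap[OF p g h b(1)[of i] b(1)[of j, unfolded gh] d that]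
      by (simp add: abs_le_iff field_simps)
    moreover have "X j (f m) - X i (f m) \<le> X j (f k) - X i (f k)" if "k \<le> m" "m < ?n" for k m
      using f(2)[OF that] by (simp only: mult_le_cancel_left_pos zero_less_numeral)
    ultimately show "gaps_match (4 * (C + 1)) (cartan p h) (\<lambda>a. X j a - X i a)"
      unfolding gaps_match_def using f(1) by (intro exI[of _ f]) simp
  qed
qed

lemma gaps_match_pair:
  fixes y :: "'n::finite \<Rightarrow> real"
  assumes "gaps_match E x y" "a \<noteq> c"
  obtains k m where "k < CARD('n)" "m < CARD('n)" "k \<noteq> m"
    "\<bar>(x ! k - x ! m) - (y a - y c)\<bar> \<le> E"
proof -
  obtain f where f: "bij_betw f {..<CARD('n)} UNIV"
    and close: "\<forall>k<CARD('n). \<forall>m<CARD('n). \<bar>(x ! k - x ! m) - (y (f k) - y (f m))\<bar> \<le> E"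
    using assms(1) unfolding gaps_match_def by (elim exE conjE)
  have "a \<in> f ` {..<CARD('n)}" "c \<in> f ` {..<CARD('n)}" using f by (auto simp: bij_betw_def)
  then obtain k m where km: "k < CARD('n)" "m < CARD('n)" "a = f k" "c = f m" by auto
  with assms(2) have "k \<noteq> m" by auto
  then show thesis using that[of k m] close km by simp
qed

text \<open>Consecutive entries of \<open>x\<close> correspond to distinct indices \<open>a\<close> and \<open>c\<close> of \<open>y\<close> in decreasing order,
  so the gap is an absolute difference.\<close>

lemma gaps_match_consecutive:
  fixes y :: "'n::finite \<Rightarrow> real"
  assumes "gaps_match E x y" "Suc k < CARD('n)"
  obtains a c where "a \<noteq> c" "x ! k - x ! Suc k \<ge> \<bar>y a - y c\<bar> - E"
proof -
  obtain f where f: "bij_betw f {..<CARD('n)} UNIV"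
    and anti: "\<forall>k m. k \<le> m \<longrightarrow> m < CARD('n) \<longrightarrow> y (f m) \<le> y (f k)"
    and close: "\<forall>k<CARD('n). \<forall>m<CARD('n). \<bar>(x ! k - x ! m) - (y (f k) - y (f m))\<bar> \<le> E"
    using assms(1) unfolding gaps_match_def by (elim exE conjE)
  have "f k \<noteq> f (Suc k)"
    using inj_onD[OF bij_betw_imp_inj_on[OF f], of k "Suc k"] assms(2) by auto
  moreover have "y (f (Suc k)) \<le> y (f k)" using anti assms(2) by simp
  moreover have "\<bar>(x ! k - x ! Suc k) - (y (f k) - y (f (Suc k)))\<bar> \<le> E"
    using close assms(2) by simp
  ultimately show thesis using that[of "f k" "f (Suc k)"] by linarith
qed


section \<open>Gaps and growth of real sequences\<close>

lemma gaps_add_up: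
  fixes x :: "nat \<Rightarrow> real"
  assumes "\<And>k. Suc k < n \<Longrightarrow> x k - x (Suc k) \<ge> T" "T \<ge> 0" "k < m" "m < n"
  shows "x k - x m \<ge> T"
  using assms(3,4)
proof (induction m)
  case (Suc m)
  show ?case
  proof (cases "k = m")
    case True
    then show ?thesis using assms(1)[of m] Suc.prems by simp
  next
    case False
    then have "x k - x m \<ge> T" using Suc by simp
    then show ?thesis using assms(1)[of m] assms(2) Suc.prems by linarith
  qed
qed simp

text \<open>Write \<open>i\<close> as a multiple of \<open>N\<close> plus a remainder: each block of length \<open>N\<close> gains \<open>T\<close>, and the
  remainder loses at most \<open>N * D\<close>.\<close>

lemma linear_escape_positive:
  fixes z :: "nat \<Rightarrow> real"
  assumes N: "N > 0" and T: "T > 0" and step: "\<And>i. \<bar>z (Suc i) - z i\<bar> \<le> D"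
    and far: "\<And>i. z (i + N) - z i \<ge> T"
  shows "z i - z 0 \<ge> T / real N * real i - (T + real N * D)"
proof -
  have slow: "\<bar>z i - z 0\<bar> \<le> real i * D" for i
  proof (induction i)
    case (Suc i)
    then show ?case using step[of i] by (simp add: algebra_simps)
  qed simp
  have fast: "z (r + m * N) - z r \<ge> real m * T" for r m
  proof (induction m)
    case (Suc m)
    then show ?case using far[of "r + m * N"] by (simp add: algebra_simps)
  qed simp
  have "D \<ge> 0" using step[of 0] by linarith
  then have "real (i mod N) * D \<le> real N * D"
    using N by (intro mult_right_mono) (simp_all add: less_imp_le)
  then have "z (i mod N) - z 0 \<ge> - (real N * D)" using slow[of "i mod N"] by linarith
  moreover have "z i - z (i mod N) \<ge> real (i div N) * T"
    using fast[where r = "i mod N" and m = "i div N"] by simp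
  moreover have "T / real N * real i - T \<le> real (i div N) * T"
  proof -
    have "real i = real (i div N) * real N + real (i mod N)"
      by (metis div_mult_mod_eq of_nat_add of_nat_mult)
    also have "\<dots> \<le> (real (i div N) + 1) * real N"
      using N by (simp add: algebra_simps less_imp_le)
    finally have "T / real N * real i \<le> T / real N * ((real (i div N) + 1) * real N)"
      using T N by (intro mult_left_mono) auto
    then show ?thesis using N by (simp add: algebra_simps)
  qed
  ultimately show ?thesis by linarith
qed

text \<open>A sequence whose displacements over \<open>N\<close> indices exceed its steps in absolute value cannot turn
  back, so it escapes linearly in one direction. In the flat this says that displacements far from
  the walls of the Weyl chambers cannot switch from one side of a wall to the other.\<close>

lemma linear_escape:
  fixes z :: "nat \<Rightarrow> real"
  assumes N: "N > 0" and step: "\<And>i. \<bar>z (Suc i) - z i\<bar> \<le> D" and D: "D < T"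
    and far: "\<And>i. \<bar>z (i + N) - z i\<bar> \<ge> T"
  shows "\<bar>z i - z 0\<bar> \<ge> T / real N * real i - (T + real N * D)"
proof -
  have T: "T > 0" using step[of 0] D by linarith
  \<comment> \<open>The increment over \<open>N\<close> indices moves by at most \<open>2 * D < 2 * T\<close> when the index moves by one,
    so it cannot jump over the interval from \<open>- T\<close> to \<open>T\<close>.\<close>
  have next_step: "z (Suc i + N) - z (Suc i) \<ge> T \<longleftrightarrow> z (i + N) - z i \<ge> T" for i
    using far[of i] far[of "Suc i"] step[of i] step[of "i + N"] D by (auto simp: abs_if split: if_splits)
  have same: "z (i + N) - z i \<ge> T \<longleftrightarrow> z N - z 0 \<ge> T" for i
    by (induction i) (simp_all only: next_step, simp)
  show ?thesis
  proof (cases "z N - z 0 \<ge> T")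
    case True
    then have "z (i + N) - z i \<ge> T" for i using same by simp
    from linear_escape_positive[of N T z D i, OF N T step this] show ?thesis by linarith
  next
    case False
    then have "- z (i + N) - - z i \<ge> T" for i using same[of i] far[of i] by linarith
    moreover have "\<bar>- z (Suc i) - - z i\<bar> \<le> D" for i using step[of i] by linarith
    ultimately have "- z i - - z 0 \<ge> T / real N * real i - (T + real N * D)"
      by (intro linear_escape_positive[of N T "\<lambda>i. - z i" D i, OF N T])
    then show ?thesis by linarith
  qed
qed


section \<open>Directed sequences\<close>

lemma list_prod_closed:
  assumes "group G" "set ws \<subseteq> carrier G"
  shows "list_prod G ws \<in> carrier G"
proof -
  interpret group G by fact
  show ?thesis using assms(2) by (induction ws) (auto simp: list_prod_def)
qed

lemma list_prod_append:
  assumes "group G" "set ws \<subseteq> carrier G" "set vs \<subseteq> carrier G"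
  shows "list_prod G (ws @ vs) = list_prod G ws \<otimes>\<^bsub>G\<^esub> list_prod G vs"
proof -
  interpret group G by fact
  have vs: "list_prod G vs \<in> carrier G" by (rule list_prod_closed[OF assms(1,3)])
  show ?thesis using assms(2)
  proof (induction ws)
    case Nil
    then show ?case using vs by (simp add: list_prod_def)
  next
    case (Cons w ws)
    then show ?case using vs list_prod_closed[OF assms(1), of ws]
      by (simp add: list_prod_def m_assoc)
  qed
qed

lemma directed_seq_carrier:
  assumes "group G" "R ` A \<subseteq> carrier G" "directed_seq G A B R \<eta>"
  shows "\<eta> i \<in> carrier G"
proof (cases "i = 0")
  case True
  then show ?thesis using assms(1,3) by (simp add: directed_seq_def group.is_monoid)
next
  case False
  obtain p where p: "directed_ray A B p" "\<And>i. i > 0 \<Longrightarrow> \<eta> i = list_prod G (map (\<lambda>j. R (p j)) [1..<Suc i])"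
    using assms(3) by (auto simp: directed_seq_def)
  have "set (map (\<lambda>j. R (p j)) [1..<Suc i]) \<subseteq> carrier G"
    using p(1) assms(2) by (auto simp: directed_ray_def)
  then show ?thesis using p(2) False list_prod_closed[OF assms(1)] by simp
qed

text \<open>The increments of a directed sequence are again directed: \<open>\<zeta>\<close> reads the same ray starting
  after the index \<open>i\<close>. This carries information about initial segments to all segments.\<close>

lemma directed_seq_tail:
  assumes G: "group G" and R: "R ` A \<subseteq> carrier G" and \<eta>: "directed_seq G A B R \<eta>"
  obtains \<zeta> where "directed_seq G A B R \<zeta>" "\<And>l. \<eta> (i + l) = \<eta> i \<otimes>\<^bsub>G\<^esub> \<zeta> l" "\<zeta> 1 \<in> R ` A"
proof -
  interpret group G by fact
  obtain p where p: "directed_ray A B p"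
    and eta: "\<And>i. i > 0 \<Longrightarrow> \<eta> i = list_prod G (map (\<lambda>j. R (p j)) [1..<Suc i])"
    using \<eta> by (auto simp: directed_seq_def)
  have prod: "\<eta> i = list_prod G (map (\<lambda>j. R (p j)) [1..<Suc i])" for i
    using eta[of i] \<eta> by (cases "i = 0") (simp_all add: directed_seq_def list_prod_def)
  have pA: "R (p j) \<in> R ` A" if "j > 0" for j using p that by (auto simp: directed_ray_def)
  then have in_G: "R (p j) \<in> carrier G" if "j > 0" for j using R that by blast
  define \<zeta> where "\<zeta> l = list_prod G (map (\<lambda>j. R (p (j + i))) [1..<Suc l])" for l
  show thesis
  proof (rule that[of \<zeta>])
    have "directed_ray A B (\<lambda>j. p (j + i))" using p by (simp add: directed_ray_def)
    then show "directed_seq G A B R \<zeta>"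
      unfolding directed_seq_def \<zeta>_def by (auto simp: list_prod_def)
    show "\<eta> (i + l) = \<eta> i \<otimes>\<^bsub>G\<^esub> \<zeta> l" for l
    proof -
      have "[1..<Suc (i + l)] = [1..<Suc i] @ map (\<lambda>j. j + i) [1..<Suc l]"
        by (induction l) (simp_all add: add.commute)
      then have "map (\<lambda>j. R (p j)) [1..<Suc (i + l)] =
          map (\<lambda>j. R (p j)) [1..<Suc i] @ map (\<lambda>j. R (p (j + i))) [1..<Suc l]"
        by (simp only: map_append map_map o_def)
      moreover have "set (map (\<lambda>j. R (p j)) [1..<Suc i]) \<subseteq> carrier G"
        "set (map (\<lambda>j. R (p (j + i))) [1..<Suc l]) \<subseteq> carrier G" using in_G by auto
      ultimately show ?thesis unfolding prod \<zeta>_def using list_prod_append[OF G] by metis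
    qed
    show "\<zeta> 1 \<in> R ` A" using pA[of "Suc i"] in_G[of "Suc i"] by (simp add: \<zeta>_def list_prod_def)
  qed
qed

text \<open>Divergence along every family of sequences is uniform divergence: if no threshold worked, choosing
  one violation for each candidate would give a family without divergence.\<close>

lemma uniform_divergence:
  fixes \<phi> :: "'r \<Rightarrow> 'g \<Rightarrow> real" and P :: "(nat \<Rightarrow> 'g) \<Rightarrow> bool"
  assumes fin: "finite Rts"
    and div: "\<And>l \<eta>. \<lbrakk>\<And>i. l i > 0; \<And>i. P (\<eta> i); filterlim l at_top sequentially\<rbrakk> \<Longrightarrow>
      \<forall>r\<in>Rts. filterlim (\<lambda>i::nat. \<phi> r (\<eta> i (l i))) at_top sequentially"
  shows "\<exists>N>0. \<forall>\<eta>. P \<eta> \<longrightarrow> (\<forall>l\<ge>N. \<forall>r\<in>Rts. \<phi> r (\<eta> l) \<ge> T)"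
proof (rule ccontr)
  assume "\<not> ?thesis"
  \<comment> \<open>\<open>Suc N\<close> rather than \<open>N\<close> keeps the chosen index positive.\<close>
  then have "\<exists>\<eta> l. P \<eta> \<and> l \<ge> Suc N \<and> (\<exists>r\<in>Rts. \<phi> r (\<eta> l) < T)" for N
    by (metis not_le zero_less_Suc)
  then obtain \<eta> l where P: "\<And>N. P (\<eta> N)" and l: "\<And>N. l N \<ge> Suc N"
    and bad: "\<And>N. \<exists>r\<in>Rts. \<phi> r (\<eta> N (l N)) < T" by metis
  have "filterlim l at_top sequentially"
    by (rule filterlim_at_top_mono[OF filterlim_Suc]) (use l in simp)
  moreover have "l N > 0" for N using l[of N] by simp
  ultimately have "\<forall>r\<in>Rts. filterlim (\<lambda>i. \<phi> r (\<eta> i (l i))) at_top sequentially"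
    using div P by blast
  then have "\<forall>r\<in>Rts. \<forall>\<^sub>F i in sequentially. \<phi> r (\<eta> i (l i)) \<ge> T"
    by (auto simp: filterlim_at_top)
  then have "\<forall>\<^sub>F i in sequentially. \<forall>r\<in>Rts. \<phi> r (\<eta> i (l i)) \<ge> T"
    by (rule eventually_ball_finite[OF fin])
  then obtain i where "\<forall>r\<in>Rts. \<phi> r (\<eta> i (l i)) \<ge> T"
    using eventually_happens trivial_limit_sequentially by blast
  then show False using bad[of i] by force
qed


section \<open>Linear growth of the simple roots\<close>

theorem theorem1p8:
  fixes \<Gamma> :: "('g, 'm) monoid_scheme" and S :: "'g set"
    and A :: "'a set" and B :: "('a \<times> 'a) set" and R :: "'a \<Rightarrow> 'g"
    and x\<^sub>0 :: "('n::finite) form set" and \<rho> :: "'g \<Rightarrow> (real ^ 'n ^ 'n) set"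
  assumes n: "CARD('n) \<ge> 2"
    and grp: "group \<Gamma>"
    and gen: "finite S" "S \<subseteq> carrier \<Gamma>" "generate \<Gamma> S = carrier \<Gamma>"
    and graph: "finite A" "B \<subseteq> A \<times> A"
    and R: "R ` A \<subseteq> carrier \<Gamma>" "inj_on R A"
    and x\<^sub>0: "x\<^sub>0 \<in> sym_space"
    and rep: "\<rho> \<in> hom \<Gamma> PGL"
    and near_flat: "\<exists>C>0. \<forall>\<eta>. directed_seq \<Gamma> A B R \<eta> \<longrightarrow>
      (\<exists>F. maximal_flat F \<and> (\<forall>i. dist_X_set (act (\<rho> (\<eta> i)) x\<^sub>0) F \<le> C))"
    and divergent: "\<And>(\<gamma> :: nat \<Rightarrow> 'g) (l :: nat \<Rightarrow> nat) (\<eta> :: nat \<Rightarrow> nat \<Rightarrow> 'g).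
      \<lbrakk>\<And>i. l i > 0; \<And>i. directed_seq \<Gamma> A B R (\<eta> i); \<And>i. \<gamma> i = \<eta> i (l i);
       filterlim l at_top sequentially\<rbrakk> \<Longrightarrow>
      \<forall>\<alpha>\<in>simple_roots CARD('n). filterlim (\<lambda>i. \<alpha> (cartan x\<^sub>0 (\<rho> (\<gamma> i)))) at_top sequentially"
  shows "directed_anosov \<Gamma> S A B R x\<^sub>0 \<rho>"
proof -
  let ?n = "CARD('n)"
  define \<mu> where "\<mu> g = cartan x\<^sub>0 (\<rho> g)" for g
  obtain C where C: "C > 0" and near: "\<And>\<eta>. directed_seq \<Gamma> A B R \<eta> \<Longrightarrow>
      \<exists>F. maximal_flat F \<and> (\<forall>i. dist_X_set (act (\<rho> (\<eta> i)) x\<^sub>0) F \<le> C)"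
    using near_flat by blast
  define E where "E = 4 * (C + 1)"
  have E: "E > 0" using C by (simp add: E_def)
  \<comment> \<open>One letter moves the gaps by a bounded amount, since there are finitely many letters.\<close>
  have "finite ((\<lambda>(a, k, m). \<bar>\<mu> (R a) ! k - \<mu> (R a) ! m\<bar>) ` (A \<times> {..<?n} \<times> {..<?n}))"
    using graph(1) by simp
  from bdd_above_finite[OF this] obtain D\<^sub>0 where D\<^sub>0: "\<And>a k m. a \<in> A \<Longrightarrow> k < ?n \<Longrightarrow> m < ?n \<Longrightarrow> \<bar>\<mu> (R a) ! k - \<mu> (R a) ! m\<bar> \<le> D\<^sub>0"
    unfolding bdd_above_def by force
  \<comment> \<open>\<open>D\<close> bounds one step of a difference of two flat coordinates. Gaps of size \<open>T + E\<close> in the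
    Cartan projection force such a difference to move by more than \<open>D\<close>.\<close>
  define D where "D = \<bar>D\<^sub>0\<bar> + E"
  define T where "T = D + 1"
  have DT: "D > 0" "T > 0" "D < T" using E by (auto simp: D_def T_def)
  have "simple_roots ?n = simple_root ` {1..?n - 1}" by (auto simp: simple_roots_def)
  then have "finite (simple_roots ?n)" by simp
  then have "\<exists>N>0. \<forall>\<eta>. directed_seq \<Gamma> A B R \<eta> \<longrightarrow>
      (\<forall>l\<ge>N. \<forall>\<alpha>\<in>simple_roots ?n. \<alpha> (\<mu> (\<eta> l)) \<ge> T + E)"
    unfolding \<mu>_def by (rule uniform_divergence) (rule divergent, auto)
  then obtain N where N: "N > 0" and big: "\<And>\<eta> l \<alpha>. directed_seq \<Gamma> A B R \<eta> \<Longrightarrow> l \<ge> N \<Longrightarrow>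
      \<alpha> \<in> simple_roots ?n \<Longrightarrow> \<alpha> (\<mu> (\<eta> l)) \<ge> T + E" by blast
  define \<kappa> where "\<kappa> = T / real N"
  define \<kappa>' where "\<kappa>' = T + real N * D + E"
  have pos: "\<kappa> > 0" "\<kappa>' > 0" using N DT E by (simp_all add: \<kappa>_def \<kappa>'_def add_pos_pos)
  have "\<alpha> (\<mu> (\<eta> i)) \<ge> \<kappa> * real i - \<kappa>'"
    if \<eta>: "directed_seq \<Gamma> A B R \<eta>" and \<alpha>: "\<alpha> \<in> simple_roots ?n" for \<eta> i \<alpha>
  proof -
    have carrier: "\<zeta> i \<in> carrier \<Gamma>" if "directed_seq \<Gamma> A B R \<zeta>" for \<zeta> i
      by (rule directed_seq_carrier[OF grp R(1) that])
    have PGL: "\<rho> g \<in> carrier PGL" if "g \<in> carrier \<Gamma>" for g using rep that by (auto simp: hom_def)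
    obtain F where F: "maximal_flat F" "\<And>i. dist_X_set (act (\<rho> (\<eta> i)) x\<^sub>0) F \<le> C"
      using near[OF \<eta>] by blast
    from flat_coordinates[where g = "\<lambda>i. \<rho> (\<eta> i)", OF x\<^sub>0 F(1) PGL[OF carrier[OF \<eta>]] F(2)]
    obtain X :: "nat \<Rightarrow> 'n \<Rightarrow> real" where X: "\<forall>i j. \<forall>h\<in>carrier PGL.
        \<rho> (\<eta> j) = \<rho> (\<eta> i) \<otimes>\<^bsub>PGL\<^esub> h \<longrightarrow> gaps_match E (cartan x\<^sub>0 h) (\<lambda>a. X j a - X i a)"
      unfolding E_def[symmetric] by (elim exE)
    have seg: "gaps_match E (\<mu> (\<zeta> l)) (\<lambda>a. X (i + l) a - X i a)"
      if "directed_seq \<Gamma> A B R \<zeta>" "\<eta> (i + l) = \<eta> i \<otimes>\<^bsub>\<Gamma>\<^esub> \<zeta> l" for i l \<zeta>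
    proof -
      have "\<rho> (\<eta> (i + l)) = \<rho> (\<eta> i) \<otimes>\<^bsub>PGL\<^esub> \<rho> (\<zeta> l)"
        unfolding that(2) by (rule hom_mult[OF rep carrier[OF \<eta>] carrier[OF that(1)]])
      then show ?thesis using X PGL[OF carrier[OF that(1)]] unfolding \<mu>_def by blast
    qed
    have escape: "\<bar>(X i a - X i c) - (X 0 a - X 0 c)\<bar> \<ge> \<kappa> * real i - (T + real N * D)"
      if ac: "a \<noteq> c" for i a c
      unfolding \<kappa>_def
    proof (rule linear_escape[OF N _ DT(3), where z = "\<lambda>i. X i a - X i c"])
      fix i
      obtain \<zeta> where \<zeta>: "directed_seq \<Gamma> A B R \<zeta>" "\<And>l. \<eta> (i + l) = \<eta> i \<otimes>\<^bsub>\<Gamma>\<^esub> \<zeta> l" "\<zeta> 1 \<in> R ` A"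
        using directed_seq_tail[OF grp R(1) \<eta>] by blast
      show "\<bar>(X (Suc i) a - X (Suc i) c) - (X i a - X i c)\<bar> \<le> D"
      proof -
        obtain k m where km: "k < ?n" "m < ?n"
          "\<bar>(\<mu> (\<zeta> 1) ! k - \<mu> (\<zeta> 1) ! m) - ((X (i + 1) a - X i a) - (X (i + 1) c - X i c))\<bar> \<le> E"
          by (rule gaps_match_pair[OF seg[OF \<zeta>(1,2)] ac])
        obtain a' where a': "\<zeta> 1 = R a'" "a' \<in> A" using \<zeta>(3) by (rule imageE)
        have "\<bar>\<mu> (\<zeta> 1) ! k - \<mu> (\<zeta> 1) ! m\<bar> \<le> D\<^sub>0"
          unfolding a'(1) by (rule D\<^sub>0[OF a'(2) km(1,2)])
        then show ?thesis using km(3) by (simp add: D_def)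
      qed
      show "T \<le> \<bar>(X (i + N) a - X (i + N) c) - (X i a - X i c)\<bar>"
      proof -
        obtain k m where km: "k < ?n" "m < ?n" "k \<noteq> m"
          "\<bar>(\<mu> (\<zeta> N) ! k - \<mu> (\<zeta> N) ! m) - ((X (i + N) a - X i a) - (X (i + N) c - X i c))\<bar> \<le> E"
          by (rule gaps_match_pair[OF seg[OF \<zeta>(1,2)] ac])
        have gap: "\<mu> (\<zeta> N) ! k - \<mu> (\<zeta> N) ! Suc k \<ge> T + E" if "Suc k < ?n" for k
        proof -
          have "simple_root (Suc k) \<in> simple_roots ?n" using that by (force simp: simple_roots_def)
          from big[OF \<zeta>(1) order_refl this] show ?thesis by (simp add: simple_root_def)
        qed
        have gaps: "\<mu> (\<zeta> N) ! k - \<mu> (\<zeta> N) ! m \<ge> T + E" if "k < m" "m < ?n" for k m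
          using gaps_add_up[where x = "\<lambda>k. \<mu> (\<zeta> N) ! k", OF gap _ that] DT E by simp
        have "k < m \<or> m < k" using km(3) by linarith
        then have "\<bar>\<mu> (\<zeta> N) ! k - \<mu> (\<zeta> N) ! m\<bar> \<ge> T + E"
          using gaps[of k m] gaps[of m k] km(1,2) by linarith
        then show ?thesis using km(4) by linarith
      qed
    qed
    obtain k where k: "\<alpha> = simple_root (Suc k)" "Suc k < ?n"
    proof -
      obtain j where "\<alpha> = simple_root j" "1 \<le> j" "j \<le> ?n - 1" using \<alpha> by (auto simp: simple_roots_def)
      then show thesis using that[of "j - 1"] n by simp
    qed
    have "\<eta> 0 = \<one>\<^bsub>\<Gamma>\<^esub>" using \<eta> by (simp add: directed_seq_def)
    then have "\<eta> (0 + i) = \<eta> 0 \<otimes>\<^bsub>\<Gamma>\<^esub> \<eta> i"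
      using grp carrier[OF \<eta>] by (simp add: group.is_monoid)
    from gaps_match_consecutive[OF seg[OF \<eta> this] k(2)] obtain a c where ac: "a \<noteq> c"
      "\<mu> (\<eta> i) ! k - \<mu> (\<eta> i) ! Suc k \<ge> \<bar>(X i a - X 0 a) - (X i c - X 0 c)\<bar> - E"
      by (metis add_0)
    with escape[OF ac(1), of i] show ?thesis
      by (simp add: k(1) simple_root_def \<kappa>'_def)
  qed
  then show ?thesis unfolding directed_anosov_def
    using pos unfolding \<mu>_def by (intro allI impI exI[of _ \<kappa>] exI[of _ \<kappa>'] conjI ballI) simp_all
qed

end
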